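(* Let $\Bbbk$ be an algebraically closed field of characteristic zero. Let $\mathbf f\in\Bbbk[x,y]$ be a polynomial of degree $n\ge4$ that is a product $\mathbf f=\prod_{i=1}^nl_i$ of distinct linear forms, i.e. $l_i=a_ix+b_iy+c_i\notin\Bbbk$ with $a_i,b_i,c_i\in\Bbbk$ and $l_i\notin\Bbbk^\times l_j$ for all $i\ne j$. Suppose that for each $i$ there are at least three $j$ such that $l_i$ and $l_j$ generate the algebra $\Bbbk[x,y]$. (1) There is an exact sequence of groups $$1\to C\to\mathrm{Aut}_{Poi}(K\{\mathbf f\})\to\mathbb S_n$$ where $C$ is a subgroup of $C_{n-2}$. As a consequence, $|\mathrm{Aut}_{Poi}(K\{\mathbf f\})|\le(n-2)\,n!$. (2) If $\mathbf f$ is homogeneous, then $C=C_{n-2}$ and $n-2\le|\mathrm{Aut}_{Poi}(K\{\mathbf f\})|$.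
   Context: For $\mathbf f\in\Bbbk(x,y)$, $K\{\mathbf f\}$ denotes the rational function field $\Bbbk(x,y)$ equipped with the unique ($\Bbbk$-bilinear) Poisson bracket such that $\{x,y\}=\mathbf f$; explicitly $\{g,h\}=\left(\frac{\partial g}{\partial x}\frac{\partial h}{\partial y}-\frac{\partial g}{\partial y}\frac{\partial h}{\partial x}\right)\mathbf f$. $\mathrm{Aut}_{Poi}(K)$ is the group of $\Bbbk$-algebra automorphisms of $K$ preserving the Poisson bracket. $C_m$ is the cyclic group of order $m$ and $\mathbb S_n$ is the symmetric group on $n$ letters. *)

theory Defs
  imports
    "HOL-Algebra.Elementary_Groups"
    "HOL-Algebra.Sym_Groups"
    "HOL-Computational_Algebra.Polynomial"
    "HOL-Computational_Algebra.Polynomial_Factorial"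
    "HOL-Computational_Algebra.Fraction_Field"
begin

text \<open>
  The polynomial ring \<open>k[x,y]\<close> is the type \<open>'k poly poly\<close>, read as \<open>k[x][y]\<close>: the inner
  variable is \<open>x\<close>, the outer one is \<open>y\<close>.  Its fraction field \<open>k(x,y)\<close> is
  \<open>'k poly poly fract\<close>.
\<close>

definition scalar2 :: "'k::field \<Rightarrow> 'k poly poly" where
  "scalar2 c = [:[:c:]:]"

definition var_x :: "'k::field poly poly" where
  "var_x = [:[:0, 1:]:]"

definition var_y :: "'k::field poly poly" where
  "var_y = [:0, 1:]"

text \<open>The exponents \<open>(i, j)\<close> of the monomials \<open>x\<^sup>i y\<^sup>j\<close> that occur in a polynomial.\<close>

definition support2 :: "'k::field poly poly \<Rightarrow> (nat \<times> nat) set" where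
  "support2 p = {(i, j). poly.coeff (poly.coeff p j) i \<noteq> 0}"

text \<open>The zero polynomial gets total degree \<open>0\<close>.\<close>

definition total_degree2 :: "'k::field poly poly \<Rightarrow> nat" where
  "total_degree2 p = Max (insert 0 ((\<lambda>(i, j). i + j) ` support2 p))"

definition homogeneous2 :: "'k::field poly poly \<Rightarrow> bool" where
  "homogeneous2 p \<longleftrightarrow> (\<exists>d. \<forall>(i, j)\<in>support2 p. i + j = d)"

text \<open>Linear forms need not be homogeneous, but they must not be constant.\<close>

definition linear_form2 :: "'k::field poly poly \<Rightarrow> bool" where
  "linear_form2 l \<longleftrightarrow>
     (\<exists>a b c. l = scalar2 a * var_x + scalar2 b * var_y + scalar2 c) \<and> l \<notin> range scalar2"

definition subalgebra2 :: "'k::field poly poly set \<Rightarrow> bool" where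
  "subalgebra2 A \<longleftrightarrow> range scalar2 \<subseteq> A \<and> (\<forall>p\<in>A. \<forall>q\<in>A. p + q \<in> A \<and> p * q \<in> A)"

definition generates2 :: "'k::field poly poly set \<Rightarrow> bool" where
  "generates2 S \<longleftrightarrow> subalgebra2 hull S = UNIV"


text \<open>Partial derivatives on \<open>k[x,y]\<close>, extended to \<open>k(x,y)\<close> by the quotient rule.\<close>

definition pdx_poly :: "'k::field poly poly \<Rightarrow> 'k poly poly" where
  "pdx_poly p = map_poly pderiv p"

definition pdy_poly :: "'k::field poly poly \<Rightarrow> 'k poly poly" where
  "pdy_poly p = pderiv p"

lemma coeff_pdx_poly: "poly.coeff (pdx_poly p) n = pderiv (poly.coeff p n)"
  by (simp add: pdx_poly_def coeff_map_poly)

lemma pderiv_of_sum: "pderiv (sum g A) = (\<Sum>i\<in>A. pderiv (g i :: 'a::field poly))"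
  by (induction A rule: infinite_finite_induct) (simp_all add: pderiv_add)

lemma pdx_poly_mult: "pdx_poly (p * q) = pdx_poly p * q + p * pdx_poly q"
proof (rule poly_eqI)
  fix n
  show "poly.coeff (pdx_poly (p * q)) n = poly.coeff (pdx_poly p * q + p * pdx_poly q) n"
    by (simp add: coeff_pdx_poly coeff_mult pderiv_of_sum pderiv_mult sum.distrib
        add.commute mult.commute[of _ "pderiv _"])
qed

lemma pdy_poly_mult: "pdy_poly (p * q) = pdy_poly p * q + p * pdy_poly q"
  by (simp add: pdy_poly_def pderiv_mult algebra_simps)

lemma quotient_rule_respects:
  fixes D :: "'a::idom \<Rightarrow> 'a"
  assumes D: "\<And>p q. D (p * q) = D p * q + p * D q"
    and eq: "a * d = c * b"
  shows "(D a * b - a * D b) * (d * d) = (D c * d - c * D d) * (b * b)"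
proof -
  have *: "D a * d + a * D d = D c * b + c * D b"
    using arg_cong[OF eq, of D] by (simp add: D)
  have "(D a * b - a * D b) * (d * d)
      = (D a * d + a * D d) * (b * d) - (a * d) * (b * D d + D b * d)"
    by (simp add: algebra_simps)
  also have "\<dots> = (D c * b + c * D b) * (b * d) - (c * b) * (b * D d + D b * d)"
    by (simp only: * eq)
  also have "\<dots> = (D c * d - c * D d) * (b * b)"
    by (simp add: algebra_simps)
  finally show ?thesis .
qed

definition quotient_rule :: "('a::idom \<Rightarrow> 'a) \<Rightarrow> 'a fract \<Rightarrow> 'a fract" where
  "quotient_rule D g =
     (THE w. \<exists>p q. q \<noteq> 0 \<and> g = Fract p q \<and> w = Fract (D p * q - p * D q) (q * q))"

lemma quotient_rule_Fract:
  assumes D: "\<And>p q. D (p * q) = D p * q + p * D q" and q: "q \<noteq> 0"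
  shows "quotient_rule D (Fract p q) = Fract (D p * q - p * D q) (q * q)"
  unfolding quotient_rule_def
proof (rule the_equality)
  show "\<exists>p' q'. q' \<noteq> 0 \<and> Fract p q = Fract p' q' \<and>
      Fract (D p * q - p * D q) (q * q) = Fract (D p' * q' - p' * D q') (q' * q')"
    using q by blast
next
  fix w
  assume "\<exists>p' q'. q' \<noteq> 0 \<and> Fract p q = Fract p' q' \<and> w = Fract (D p' * q' - p' * D q') (q' * q')"
  then obtain p' q' where *: "q' \<noteq> 0" "Fract p q = Fract p' q'"
      "w = Fract (D p' * q' - p' * D q') (q' * q')"
    by blast
  then have "p' * q = p * q'"
    using q by (simp add: eq_fract)
  then show "w = Fract (D p * q - p * D q) (q * q)"
    using quotient_rule_respects[OF D, of p' q p q'] * q by (simp add: eq_fract)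
qed

definition pdx :: "'k::field poly poly fract \<Rightarrow> 'k poly poly fract" where
  "pdx = quotient_rule pdx_poly"

definition pdy :: "'k::field poly poly fract \<Rightarrow> 'k poly poly fract" where
  "pdy = quotient_rule pdy_poly"

lemma pdx_Fract: "q \<noteq> 0 \<Longrightarrow> pdx (Fract p q) = Fract (pdx_poly p * q - p * pdx_poly q) (q * q)"
  unfolding pdx_def by (rule quotient_rule_Fract[OF pdx_poly_mult])

lemma pdy_Fract: "q \<noteq> 0 \<Longrightarrow> pdy (Fract p q) = Fract (pdy_poly p * q - p * pdy_poly q) (q * q)"
  unfolding pdy_def by (rule quotient_rule_Fract[OF pdy_poly_mult])


text \<open>The bracket of the Poisson field \<open>K{f}\<close>.\<close>

definition poisson_bracket ::
    "'k::field poly poly fract \<Rightarrow> 'k poly poly fract \<Rightarrow> 'k poly poly fract \<Rightarrow> 'k poly poly fract"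
  where "poisson_bracket f g h = (pdx g * pdy h - pdy g * pdx h) * f"

lemma poisson_bracket_x_y:
  fixes f :: "'k::field poly poly fract"
  shows "poisson_bracket f (to_fract var_x) (to_fract var_y) = f"
proof -
  have "pdx (to_fract var_x) = (1 :: 'k poly poly fract)"
      "pdy (to_fract var_y) = (1 :: 'k poly poly fract)"
      "pdy (to_fract var_x) = (0 :: 'k poly poly fract)"
    by (simp_all add: to_fract_def pdx_Fract pdy_Fract pdx_poly_def pdy_poly_def var_x_def var_y_def
        map_poly_pCons map_poly_1 pderiv_pCons One_fract_def Zero_fract_def one_pCons)
  then show ?thesis
    by (simp add: poisson_bracket_def)
qed

definition poisson_automorphism ::
    "'k::field poly poly fract \<Rightarrow> ('k poly poly fract \<Rightarrow> 'k poly poly fract) \<Rightarrow> bool"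
  where "poisson_automorphism f \<phi> \<longleftrightarrow>
    bij \<phi> \<and> \<phi> 1 = 1 \<and>
    (\<forall>g h. \<phi> (g + h) = \<phi> g + \<phi> h) \<and> (\<forall>g h. \<phi> (g * h) = \<phi> g * \<phi> h) \<and>
    (\<forall>c. \<phi> (to_fract (scalar2 c)) = to_fract (scalar2 c)) \<and>
    (\<forall>g h. \<phi> (poisson_bracket f g h) = poisson_bracket f (\<phi> g) (\<phi> h))"

definition Aut_Poi ::
    "'k::field poly poly fract \<Rightarrow> ('k poly poly fract \<Rightarrow> 'k poly poly fract) monoid"
  where "Aut_Poi f = \<lparr>carrier = {\<phi>. poisson_automorphism f \<phi>}, monoid.mult = (\<circ>), one = id\<rparr>"


text \<open>
  Exactness of \<open>1 \<longrightarrow> G \<longrightarrow> H \<longrightarrow> L\<close>.  The library predicate \<open>exact_seq\<close> does not apply, since it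
  requires all groups of the sequence to live on the same type.
\<close>

definition left_exact ::
    "('a, 'm) monoid_scheme \<Rightarrow> ('a \<Rightarrow> 'b) \<Rightarrow> ('b, 'n) monoid_scheme \<Rightarrow> ('b \<Rightarrow> 'c) \<Rightarrow>
     ('c, 'p) monoid_scheme \<Rightarrow> bool"
  where "left_exact G \<iota> H \<pi> L \<longleftrightarrow>
    group_hom G H \<iota> \<and> group_hom H L \<pi> \<and>
    kernel G H \<iota> = {\<one>\<^bsub>G\<^esub>} \<and> \<iota> ` carrier G = kernel H L \<pi>"

end

theory Submission
  imports Defs "Berlekamp_Zassenhaus.Unique_Factorization_Poly"
begin

text \<open>
  Let \<open>\<phi>\<close> be a Poisson automorphism. If \<open>\<phi> x\<close> or \<open>\<phi> y\<close> had a pole along an irreducible polynomial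
  \<open>p\<close>, then comparing orders along \<open>p\<close> in \<open>{\<phi> l\<^sub>i, \<phi> l\<^sub>j} = \<delta> \<phi> f\<close>, with \<open>\<delta>\<close> a nonzero constant,
  would give a contradiction: the three lines transversal to \<open>l\<^sub>i\<close> make the pole of \<open>\<phi> f\<close> deeper than a
  Jacobian determinant allows. Hence \<open>\<phi>\<close> restricts to an automorphism of \<open>k[x,y]\<close>, and by unique
  factorization it permutes the \<open>l\<^sub>i\<close> up to scalars. If the permutation is trivial, the
  transversality assumption forces all the scalars to be equal to one scalar \<open>u\<close>, and comparing the
  degrees \<open>n\<close> and \<open>2\<close> of the two sides gives \<open>u\<^sup>n = u\<^sup>2\<close>. If \<open>f\<close> is homogeneous, the
  Euler derivation shows that all lines pass through the origin, so every such scaling occurs.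
\<close>

text \<open>The number three is dictated by simple poles. If m \<ge> 1 is the larger pole order of
  \<open>\<phi> x\<close> and \<open>\<phi> y\<close> along \<open>p\<close>, comparing orders
  yields 3 m \<le> m + 1, which is absurd. Two transversal lines would only yield 2 m \<le> m + 1,
  and the naive Jacobian bound, which loses one order per derivative, would only yield 3 m \<le> m +
  2; both allow m = 1. So the third line and the cancellation inside the Jacobian are both spent on
  the case m = 1. The permutation rests on a divisibility: once all images are polynomials, so is
  their Jacobian, and \<open>f\<close> divides the product of the images of the lines. That these
  images are irreducible uses that the inverse automorphism preserves \<open>k[x,y]\<close> as well.
  The group C is encoded by exponents: with \<zeta> a primitive root of unity of order n - 2, it
  consists of those k for which \<zeta> to the power k is the scaling factor of an automorphism.
  Algebraic closedness and characteristic zero serve to provide \<zeta>.\<close>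

hide_const (open) Divisibility.irreducible Divisibility.prime
declare ufd_class.prime_elem_iff_irreducible [iff del]

section \<open>Orders along a prime\<close>

text \<open>Existence of factorizations into irreducibles, recast as an induction on the number of
  prime factors. It serves both to split off the power of a prime and to cancel
  denominators.\<close>

lemma ufd_prime_induct [consumes 1, case_names unit prime]:
  fixes a :: "'a::ufd"
  assumes "a \<noteq> 0"
    and "\<And>u. u dvd 1 \<Longrightarrow> P u"
    and "\<And>p a. prime_elem p \<Longrightarrow> a \<noteq> 0 \<Longrightarrow> P a \<Longrightarrow> P (p * a)"
  shows "P a"
proof -
  have *: "P (prod_mset F) \<and> prod_mset F \<noteq> 0" if "\<And>q. q \<in># F \<Longrightarrow> irreducible q" for F :: "'a multiset"
    using that by (induction F) (auto simp: assms(2,3) ufd_class.prime_elem_iff_irreducible)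
  show ?thesis
  proof (cases "a dvd 1")
    case False
    then obtain F where "mset_factors F a"
      using mset_factors_exist assms(1) by blast
    then show ?thesis
      using *[of F] by (auto simp: mset_factors_def)
  qed (rule assms(2))
qed

lemma prime_elem_dvd_prodE:
  fixes p :: "'a::comm_semiring_1"
  assumes "prime_elem p" "finite A" "p dvd (\<Prod>i\<in>A. g i)"
  obtains i where "i \<in> A" "p dvd g i"
proof -
  have "\<exists>i\<in>A. p dvd g i"
    using assms(2,3)
  proof (induction A)
    case empty
    then show ?case
      using assms(1) by (simp add: prime_elem_def)
  next
    case (insert x A)
    then have "p dvd g x \<or> p dvd (\<Prod>i\<in>A. g i)"
      using assms(1) by (simp add: prime_elem_dvd_mult_iff)
    then show ?case
      using insert.IH by auto
  qed
  then show ?thesis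
    using that by blast
qed

text \<open>Multiplying by a prime \<open>q\<close> raises the exponent by one if \<open>p\<close>
  divides \<open>q\<close>, since then \<open>q\<close> is \<open>p\<close> times a unit, and leaves
  it unchanged otherwise.\<close>

lemma prime_power_decomposition:
  fixes a :: "'a::ufd"
  assumes p: "prime_elem p" and "a \<noteq> 0"
  obtains k b where "a = p ^ k * b" "\<not> p dvd b"
proof -
  have "\<exists>k b. a = p ^ k * b \<and> \<not> p dvd b"
    using \<open>a \<noteq> 0\<close>
  proof (induction rule: ufd_prime_induct)
    case (unit u)
    then have "u = p ^ 0 * u \<and> \<not> p dvd u"
      using p by (auto simp: prime_elem_def dest: dvd_trans)
    then show ?case
      by blast
  next
    case (prime q a)
    then obtain k b where kb: "a = p ^ k * b" "\<not> p dvd b"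
      by (elim exE conjE)
    show ?case
    proof (cases "p dvd q")
      case True
      then obtain w where w: "q = p * w" ..
      have "irreducible q"
        using prime(1) by (simp add: ufd_class.prime_elem_iff_irreducible)
      then have "w dvd 1"
        using w p irreducibleD by (metis prime_elem_def)
      then have "\<not> p dvd w * b"
        using kb(2) p by (meson dvd_trans prime_elem_def prime_elem_dvd_mult_iff)
      moreover have "q * a = p ^ Suc k * (w * b)"
        by (simp add: w kb(1) algebra_simps)
      ultimately show ?thesis
        by blast
    next
      case False
      then have "\<not> p dvd q * b"
        using kb(2) p by (simp add: prime_elem_dvd_mult_iff)
      moreover have "q * a = p ^ k * (q * b)"
        by (simp add: kb(1) algebra_simps)
      ultimately show ?thesis
        by blast
    qed
  qed
  then show ?thesis
    using that by blast
qed

section \<open>The valuation of the fraction field at a prime\<close>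

definition localization_at :: "'a::idom \<Rightarrow> 'a fract set" where
  "localization_at p = {Fract a b | a b. \<not> p dvd b}"

text \<open>The order of 0 is unspecified, as no \<open>k\<close> fits; hence the nonvanishing
  hypotheses in what follows.\<close>

definition ord_at :: "'a::idom \<Rightarrow> 'a fract \<Rightarrow> int" where
  "ord_at p g = (THE k. \<exists>a b. \<not> p dvd a \<and> \<not> p dvd b \<and> g = to_fract p powi k * Fract a b)"

text \<open>Unlike \<open>ord_at\<close>, this is meaningful at 0, where every bound holds for prime
  \<open>p\<close>. Sums can thus be estimated before they are known to be nonzero.\<close>

definition ord_ge :: "'a::idom \<Rightarrow> int \<Rightarrow> 'a fract \<Rightarrow> bool" where
  "ord_ge p k g \<longleftrightarrow> to_fract p powi (- k) * g \<in> localization_at p"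

context
  fixes p :: "'a::idom"
  assumes p: "prime_elem p"
begin

lemma prime_elem_not_0: "p \<noteq> 0"
  using p by (simp add: prime_elem_def)

lemma not_dvd_imp_nonzero: "\<not> p dvd b \<Longrightarrow> b \<noteq> 0"
  by auto

lemma Fract_in_localization: "\<not> p dvd b \<Longrightarrow> Fract a b \<in> localization_at p"
  by (auto simp: localization_at_def)

lemma to_fract_in_localization [intro, simp]: "to_fract a \<in> localization_at p"
  using p by (auto simp: localization_at_def to_fract_def prime_elem_def)

lemma localization_1 [intro, simp]: "1 \<in> localization_at p"
  by (metis to_fract_1 to_fract_in_localization)

lemma localization_add [intro]:
  assumes "g \<in> localization_at p" "h \<in> localization_at p"
  shows "g + h \<in> localization_at p"
proof -
  obtain a b c d where "g = Fract a b" "h = Fract c d" "\<not> p dvd b" "\<not> p dvd d"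
    using assms by (auto simp: localization_at_def)
  then show ?thesis
    using Fract_in_localization[of "b * d" "a * d + c * b"] p
    by (simp add: not_dvd_imp_nonzero prime_elem_dvd_mult_iff)
qed

lemma localization_mult [intro]:
  assumes "g \<in> localization_at p" "h \<in> localization_at p"
  shows "g * h \<in> localization_at p"
proof -
  obtain a b c d where "g = Fract a b" "h = Fract c d" "\<not> p dvd b" "\<not> p dvd d"
    using assms by (auto simp: localization_at_def)
  then show ?thesis
    using Fract_in_localization[of "b * d" "a * c"] p by (simp add: prime_elem_dvd_mult_iff)
qed

lemma localization_uminus [intro]: "g \<in> localization_at p \<Longrightarrow> - g \<in> localization_at p"
  using localization_mult[of "to_fract (- 1)" g] to_fract_in_localization[of "- 1"]
  by (simp del: to_fract_in_localization)

lemma localization_diff [intro]: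
  "g \<in> localization_at p \<Longrightarrow> h \<in> localization_at p \<Longrightarrow> g - h \<in> localization_at p"
  using localization_add[of g "- h"] localization_uminus[of h] by simp

text \<open>If \<open>k\<close> exceeded \<open>m\<close>, cancelling and clearing denominators
  would leave a positive power of \<open>p\<close> dividing \<open>c * b\<close>. The hypotheses are
  symmetric, so this one inequality gives uniqueness of the exponent.\<close>

lemma prime_powi_unique:
  assumes "\<not> p dvd a" "\<not> p dvd b" "\<not> p dvd c" "\<not> p dvd d"
    and eq: "to_fract p powi k * Fract a b = to_fract p powi m * Fract c d"
  shows "k \<le> m"
proof (rule ccontr)
  assume "\<not> k \<le> m"
  define j where "j = nat (k - m)"
  have j: "k = m + int j" "j > 0"
    using \<open>\<not> k \<le> m\<close> by (auto simp: j_def)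
  have nz: "a \<noteq> 0" "b \<noteq> 0" "c \<noteq> 0" "d \<noteq> 0" "p \<noteq> 0"
    using assms(1-4) prime_elem_not_0 by auto
  have "to_fract p powi m * (to_fract p ^ j * Fract a b) = to_fract p powi m * Fract c d"
    using eq nz by (simp add: j(1) power_int_add mult.assoc)
  then have "to_fract p ^ j * Fract a b = Fract c d"
    using nz by simp
  then have "to_fract (p ^ j * (a * d)) = to_fract (c * b)"
    using nz by (simp add: Fract_conv_to_fract field_simps to_fract_hom.hom_power)
  then have "p ^ j * (a * d) = c * b"
    by (simp only: to_fract_eq_iff)
  then have "p dvd c * b"
    using j(2) by (metis dvd_mult2 dvd_power)
  then show False
    using assms p by (simp add: prime_elem_dvd_mult_iff)
qed

lemma ord_at_eqI:
  assumes "\<not> p dvd a" "\<not> p dvd b" "g = to_fract p powi k * Fract a b"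
  shows "ord_at p g = k"
  unfolding ord_at_def
proof (rule the_equality)
  show "\<exists>a b. \<not> p dvd a \<and> \<not> p dvd b \<and> g = to_fract p powi k * Fract a b"
    using assms by blast
  show "m = k" if "\<exists>a b. \<not> p dvd a \<and> \<not> p dvd b \<and> g = to_fract p powi m * Fract a b" for m
    using that assms prime_powi_unique by (metis order_antisym)
qed

end

context
  fixes p :: "'a::ufd"
  assumes p: "prime_elem p"
begin

lemma ord_at_decomposition:
  assumes "g \<noteq> 0"
  obtains a b where "\<not> p dvd a" "\<not> p dvd b" "g = to_fract p powi ord_at p g * Fract a b"
proof -
  obtain c d where g: "g = Fract c d" "d \<noteq> 0"
    by (cases g)
  have "c \<noteq> 0"
    using assms g by (auto simp: fract_collapse)
  obtain i a where a: "c = p ^ i * a" "\<not> p dvd a"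
    using prime_power_decomposition[OF p \<open>c \<noteq> 0\<close>] .
  obtain j b where b: "d = p ^ j * b" "\<not> p dvd b"
    using prime_power_decomposition[OF p \<open>d \<noteq> 0\<close>] .
  have "g = to_fract p powi (int i - int j) * Fract a b"
    using prime_elem_not_0[OF p]
    by (simp add: g(1) a(1) b(1) Fract_conv_to_fract power_int_diff to_fract_hom.hom_power)
  moreover from this have "ord_at p g = int i - int j"
    using ord_at_eqI[OF p] a b by blast
  ultimately show ?thesis
    using that a b by simp
qed

lemma ord_at_mult:
  assumes "g \<noteq> 0" "h \<noteq> 0"
  shows "ord_at p (g * h) = ord_at p g + ord_at p h"
proof -
  obtain a b where g: "\<not> p dvd a" "\<not> p dvd b" "g = to_fract p powi ord_at p g * Fract a b"
    using ord_at_decomposition[OF assms(1)] .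
  obtain c d where h: "\<not> p dvd c" "\<not> p dvd d" "h = to_fract p powi ord_at p h * Fract c d"
    using ord_at_decomposition[OF assms(2)] .
  have "g * h = to_fract p powi (ord_at p g + ord_at p h) * Fract (a * c) (b * d)"
    using prime_elem_not_0[OF p] by (subst g(3), subst h(3)) (simp add: power_int_add mult_ac)
  moreover have "\<not> p dvd a * c" "\<not> p dvd b * d"
    using g h p by (simp_all add: prime_elem_dvd_mult_iff)
  ultimately show ?thesis
    by (intro ord_at_eqI[OF p])
qed

lemma ord_at_prod:
  assumes "finite A" "\<And>i. i \<in> A \<Longrightarrow> g i \<noteq> 0"
  shows "ord_at p (\<Prod>i\<in>A. g i) = (\<Sum>i\<in>A. ord_at p (g i))"
  using assms
proof (induction A)
  case empty
  show ?case
    using p ord_at_eqI[OF p, of 1 1 1 0] by (auto simp: prime_elem_def One_fract_def)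
qed (simp add: ord_at_mult)

lemma ord_at_unit:
  assumes "u dvd 1"
  shows "ord_at p (to_fract u) = 0"
proof -
  have "\<not> p dvd u" "\<not> p dvd 1"
    using p assms by (auto simp: prime_elem_def dest: dvd_trans)
  then show ?thesis
    by (intro ord_at_eqI[OF p]) (auto simp: to_fract_def)
qed

lemma localization_iff_ord_at:
  assumes "g \<noteq> 0"
  shows "g \<in> localization_at p \<longleftrightarrow> ord_at p g \<ge> 0"
proof
  assume "g \<in> localization_at p"
  then obtain c d where g: "g = Fract c d" "\<not> p dvd d"
    by (auto simp: localization_at_def)
  have "c \<noteq> 0"
    using assms g by (auto simp: fract_collapse)
  obtain i a where a: "c = p ^ i * a" "\<not> p dvd a"
    using prime_power_decomposition[OF p \<open>c \<noteq> 0\<close>] .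
  have "ord_at p g = int i"
    using a g by (intro ord_at_eqI[OF p]) (auto simp: Fract_conv_to_fract to_fract_hom.hom_power)
  then show "ord_at p g \<ge> 0"
    by simp
next
  assume nonneg: "ord_at p g \<ge> 0"
  obtain a b where g: "\<not> p dvd a" "\<not> p dvd b" "g = to_fract p powi ord_at p g * Fract a b"
    using ord_at_decomposition[OF assms] .
  have "g = to_fract p powi int (nat (ord_at p g)) * Fract a b"
    using g(3) nonneg by simp
  also have "\<dots> = Fract (p ^ nat (ord_at p g) * a) b"
    unfolding power_int_of_nat by (simp add: Fract_conv_to_fract to_fract_hom.hom_power)
  finally show "g \<in> localization_at p"
    using g(2) by (auto simp: localization_at_def)
qed

lemma ord_at_powi: "ord_at p (to_fract p powi k) = k"
  using p by (intro ord_at_eqI[OF p, of 1 1]) (auto simp: prime_elem_def One_fract_def[symmetric])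

lemma localization_mult_powi_iff:
  assumes "g \<noteq> 0"
  shows "to_fract p powi (- k) * g \<in> localization_at p \<longleftrightarrow> ord_at p g \<ge> k"
  using assms prime_elem_not_0[OF p]
  by (subst localization_iff_ord_at) (auto simp: ord_at_mult ord_at_powi)

lemma ord_ge_iff: "g \<noteq> 0 \<Longrightarrow> ord_ge p k g \<longleftrightarrow> ord_at p g \<ge> k"
  unfolding ord_ge_def by (rule localization_mult_powi_iff)

lemma ord_ge_add: "ord_ge p k g \<Longrightarrow> ord_ge p k h \<Longrightarrow> ord_ge p k (g + h)"
  using localization_add[OF p] by (simp add: ord_ge_def distrib_left)

lemma ord_ge_mult:
  assumes "g \<in> localization_at p" "ord_ge p k h"
  shows "ord_ge p k (g * h)"
  using localization_mult[OF p assms(1)] assms(2) by (simp add: ord_ge_def mult.left_commute)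

lemma ord_ge_to_fract:
  assumes "k \<le> 0"
  shows "ord_ge p k (to_fract a)"
proof -
  have "to_fract p powi (- k) = to_fract (p ^ nat (- k))"
    using assms by (simp add: power_int_def to_fract_hom.hom_power)
  then have "to_fract p powi (- k) * to_fract a = to_fract (p ^ nat (- k) * a)"
    by simp
  then show ?thesis
    unfolding ord_ge_def using to_fract_in_localization[OF p] by metis
qed

end

text \<open>A factorial ring is the intersection of its localizations at primes. Any prime
  \<open>p\<close> in the denominator cancels: a second representation \<open>c / d\<close> with
  \<open>p\<close> not dividing \<open>d\<close> forces \<open>p\<close> to divide the
  numerator.\<close>

lemma in_range_to_fractI:
  fixes g :: "'a::ufd fract"
  assumes "\<And>p. prime_elem p \<Longrightarrow> g \<in> localization_at p"
  shows "g \<in> range to_fract"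
proof -
  obtain a b where g: "g = Fract a b" "b \<noteq> 0"
    by (cases g)
  have "g \<in> range to_fract" if "b \<noteq> 0" "g = Fract a b" for a
    using that
  proof (induction b arbitrary: a rule: ufd_prime_induct)
    case (unit u)
    then obtain w where w: "1 = u * w"
      by (elim dvdE)
    then have "u \<noteq> 0"
      by auto
    then have "g = to_fract (a * w)"
      using w unit by (simp add: to_fract_def eq_fract mult_ac)
    then show ?case
      by blast
  next
    case (prime p b)
    obtain c d where cd: "g = Fract c d" "\<not> p dvd d"
      using assms[OF prime(1)] by (auto simp: localization_at_def)
    have nz: "d \<noteq> 0" "p \<noteq> 0"
      using cd(2) prime(1) by (auto simp: prime_elem_def)
    then have "a * d = c * (p * b)"
      using cd(1) prime(2,4) by (simp add: eq_fract)
    then have "p dvd a * d"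
      by simp
    then obtain a' where "a = p * a'"
      using prime(1) cd(2) by (auto simp: prime_elem_dvd_mult_iff)
    then have "g = Fract a' b"
      using prime(2,4) nz by (simp add: mult_fract_cancel)
    then show ?case
      using prime(3) by blast
  qed
  then show ?thesis
    using g by blast
qed

section \<open>Derivations of a fraction field\<close>

definition derivation :: "('a::comm_ring_1 \<Rightarrow> 'a) \<Rightarrow> bool" where
  "derivation D \<longleftrightarrow> (\<forall>a b. D (a + b) = D a + D b) \<and> (\<forall>a b. D (a * b) = D a * b + a * D b)"

context
  fixes D :: "'a::comm_ring_1 \<Rightarrow> 'a"
  assumes D: "derivation D"
begin

lemma derivation_add: "D (a + b) = D a + D b"
  and derivation_mult: "D (a * b) = D a * b + a * D b"
  using D by (simp_all add: derivation_def)

lemma derivation_1: "D 1 = 0"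
  using derivation_mult[of 1 1] by simp

lemma derivation_prod:
  assumes "finite A"
  shows "D (\<Prod>i\<in>A. g i) = (\<Sum>i\<in>A. D (g i) * (\<Prod>j\<in>A - {i}. g j))"
  using assms
proof (induction A)
  case (insert x A)
  have "(\<Prod>j\<in>insert x A - {i}. g j) = g x * (\<Prod>j\<in>A - {i}. g j)" if "i \<in> A" for i
  proof -
    have "insert x A - {i} = insert x (A - {i})"
      using insert that by auto
    then show ?thesis
      using insert by simp
  qed
  then have "(\<Sum>i\<in>A. D (g i) * (\<Prod>j\<in>insert x A - {i}. g j))
      = g x * (\<Sum>i\<in>A. D (g i) * (\<Prod>j\<in>A - {i}. g j))"
    by (simp add: sum_distrib_left mult_ac cong: sum.cong)
  moreover have "insert x A - {x} = A"
    using insert by auto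
  ultimately show ?case
    using insert by (simp add: derivation_mult)
qed (simp add: derivation_1)

end

lemma derivation_quotient_rule:
  fixes D :: "'a::idom \<Rightarrow> 'a"
  assumes D: "derivation D"
  shows "derivation (quotient_rule D)"
  unfolding derivation_def
proof (intro conjI allI)
  fix g h :: "'a fract"
  obtain a b where g: "g = Fract a b" "b \<noteq> 0"
    by (cases g)
  obtain c d where h: "h = Fract c d" "d \<noteq> 0"
    by (cases h)
  note rule = quotient_rule_Fract[OF derivation_mult[OF D]]
  have sum: "Fract a b + Fract c d = Fract (a * d + c * b) (b * d)"
    using g h by simp
  have nz: "b * d \<noteq> 0" "b * b \<noteq> 0" "d * d \<noteq> 0" "(b * d) * (b * d) \<noteq> 0" "(b * b) * (d * d) \<noteq> 0"
    using g h by simp_all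
  show "quotient_rule D (g + h) = quotient_rule D g + quotient_rule D h"
    unfolding g(1) h(1) sum rule[OF nz(1)] rule[OF g(2)] rule[OF h(2)]
      add_fract[OF nz(2,3)] eq_fract(1)[OF nz(4,5)] derivation_add[OF D] derivation_mult[OF D]
    by (simp add: algebra_simps)
  show "quotient_rule D (g * h) = quotient_rule D g * h + g * quotient_rule D h"
  proof -
    have nz': "b * b * d \<noteq> 0" "b * (d * d) \<noteq> 0" "b * b * d * (b * (d * d)) \<noteq> 0"
      using g h by simp_all
    show ?thesis
      unfolding g(1) h(1) mult_fract rule[OF nz(1)] rule[OF g(2)] rule[OF h(2)]
        add_fract[OF nz'(1,2)] eq_fract(1)[OF nz(4) nz'(3)] derivation_mult[OF D]
      by (simp add: algebra_simps)
  qed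
qed

lemma quotient_rule_to_fract:
  assumes "derivation D"
  shows "quotient_rule D (to_fract a) = to_fract (D a)"
  using assms
  by (simp add: to_fract_def quotient_rule_Fract derivation_mult derivation_1)

lemma derivation_pdx_poly: "derivation (pdx_poly :: 'k::field poly poly \<Rightarrow> _)"
  by (auto simp: derivation_def pdx_poly_mult poly_eq_iff coeff_pdx_poly pderiv_add)

lemma derivation_pdy_poly: "derivation (pdy_poly :: 'k::field poly poly \<Rightarrow> _)"
  unfolding derivation_def by (auto simp: pdy_poly_mult) (simp add: pdy_poly_def pderiv_add)

lemma derivation_pdx: "derivation (pdx :: 'k::field poly poly fract \<Rightarrow> _)"
  unfolding pdx_def by (rule derivation_quotient_rule[OF derivation_pdx_poly])

lemma derivation_pdy: "derivation (pdy :: 'k::field poly poly fract \<Rightarrow> _)"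
  unfolding pdy_def by (rule derivation_quotient_rule[OF derivation_pdy_poly])

lemma pdx_to_fract: "pdx (to_fract a) = to_fract (pdx_poly a)"
  unfolding pdx_def by (rule quotient_rule_to_fract[OF derivation_pdx_poly])

lemma pdy_to_fract: "pdy (to_fract a) = to_fract (pdy_poly a)"
  unfolding pdy_def by (rule quotient_rule_to_fract[OF derivation_pdy_poly])

section \<open>Logarithmic derivatives and the order of a Jacobian\<close>

context
  fixes D :: "'a::field \<Rightarrow> 'a"
  assumes D: "derivation D"
begin

lemma log_derivative_mult:
  assumes "a \<noteq> 0" "b \<noteq> 0"
  shows "D (a * b) / (a * b) = D a / a + D b / b"
  using assms by (simp add: derivation_mult[OF D] field_simps)

lemma log_derivative_divide:
  assumes "a \<noteq> 0" "b \<noteq> 0"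
  shows "D (a / b) / (a / b) = D a / a - D b / b"
  using log_derivative_mult[of "a / b" b] assms by simp

lemma log_derivative_power:
  assumes "a \<noteq> 0"
  shows "D (a ^ k) / a ^ k = of_nat k * (D a / a)"
proof (induction k)
  case (Suc k)
  show ?case
    using log_derivative_mult[of a "a ^ k"] assms Suc by (simp add: distrib_right add_divide_distrib)
qed (simp add: derivation_1[OF D])

lemma log_derivative_powi:
  assumes "a \<noteq> 0"
  shows "D (a powi k) / a powi k = of_int k * (D a / a)"
proof (cases k)
  case (nonneg m)
  then show ?thesis
    using log_derivative_power[OF assms] by simp
next
  case (neg m)
  have "a powi k = 1 / a ^ Suc m"
    unfolding neg power_int_minus power_int_of_nat by (simp add: field_simps)
  then show ?thesis
    using log_derivative_divide[of 1 "a ^ Suc m"] log_derivative_power[of a "Suc m"] assms neg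
    by (simp add: derivation_1[OF D] del: power_Suc) (simp add: field_simps)
qed

end

context
  fixes p :: "'a::ufd" and P
  defines "P \<equiv> to_fract p"
  assumes p: "prime_elem p"
begin

text \<open>In \<open>D g / g\<close> the unit part \<open>a / b\<close> of \<open>g\<close>
  contributes only denominators \<open>a\<close> and \<open>b\<close>, which are prime to
  \<open>p\<close>, because \<open>D\<close> preserves the ring. The whole pole along
  \<open>p\<close> therefore sits in a multiple of \<open>D P / P\<close>, whatever the
  derivation.\<close>

lemma log_derivative_mod_localization:
  assumes D: "derivation D" "\<And>a. D (to_fract a) \<in> range to_fract" and "g \<noteq> 0"
  shows "D g / g - of_int (ord_at p g) * (D P / P) \<in> localization_at p"
proof -
  obtain a b where ab: "\<not> p dvd a" "\<not> p dvd b" "g = P powi ord_at p g * Fract a b"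
    using ord_at_decomposition[OF p \<open>g \<noteq> 0\<close>] unfolding P_def .
  have nz: "P \<noteq> 0" "to_fract a \<noteq> 0" "to_fract b \<noteq> 0"
    using ab p by (auto simp: P_def prime_elem_def)
  have *: "D (to_fract c) / to_fract c \<in> localization_at p" if "\<not> p dvd c" for c
  proof -
    obtain d where "D (to_fract c) = to_fract d"
      using D(2) by blast
    then show ?thesis
      using Fract_in_localization[OF p that, of d] by (simp add: Fract_conv_to_fract)
  qed
  have g: "P powi ord_at p g * (to_fract a / to_fract b) = g"
    using ab(3) by (simp add: Fract_conv_to_fract)
  have "D g / g = D (P powi ord_at p g) / P powi ord_at p g
      + D (to_fract a / to_fract b) / (to_fract a / to_fract b)"
    using log_derivative_mult[OF D(1), of "P powi ord_at p g" "to_fract a / to_fract b"] nz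
    unfolding g by simp
  also have "\<dots> = of_int (ord_at p g) * (D P / P)
      + (D (to_fract a) / to_fract a - D (to_fract b) / to_fract b)"
    using log_derivative_divide[OF D(1) nz(2,3)] log_derivative_powi[OF D(1) nz(1)] by simp
  finally have "D g / g = of_int (ord_at p g) * (D P / P)
      + (D (to_fract a) / to_fract a - D (to_fract b) / to_fract b)" .
  then have "D g / g - of_int (ord_at p g) * (D P / P)
      = D (to_fract a) / to_fract a - D (to_fract b) / to_fract b"
    by simp
  then show ?thesis
    using localization_diff[OF p] * ab(1,2) by presburger
qed

lemma of_int_in_localization: "of_int k \<in> localization_at p"
proof -
  have "of_nat m \<in> localization_at p" for m
    by (induction m) (use localization_add[OF p] localization_1[OF p] to_fract_in_localization[OF p, of 0] in auto)
  then show ?thesis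
    by (cases k rule: int_cases2) (auto intro: localization_uminus[OF p])
qed

text \<open>
  The bound loses only one order: the terms with a double pole along \<open>p\<close> carry the factor
  \<open>D P \<and> D P = 0\<close>.
\<close>

lemma ord_at_jacobian:
  assumes D1: "derivation D1" "\<And>a. D1 (to_fract a) \<in> range to_fract"
    and D2: "derivation D2" "\<And>a. D2 (to_fract a) \<in> range to_fract"
    and "g \<noteq> 0" "h \<noteq> 0" and J: "D1 g * D2 h - D2 g * D1 h \<noteq> 0"
  shows "ord_at p (D1 g * D2 h - D2 g * D1 h) \<ge> ord_at p g + ord_at p h - 1"
proof -
  define J where "J = D1 g * D2 h - D2 g * D1 h"
  have "P \<noteq> 0"
    using p by (auto simp: P_def prime_elem_def)
  define \<alpha> \<beta> :: "'a fract" where "\<alpha> = of_int (ord_at p g)" and "\<beta> = of_int (ord_at p h)"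
  define w1 w2 where "w1 = D1 P / P" and "w2 = D2 P / P"
  define r1 r2 s1 s2 where "r1 = D1 g / g - \<alpha> * w1" and "r2 = D2 g / g - \<alpha> * w2"
    and "s1 = D1 h / h - \<beta> * w1" and "s2 = D2 h / h - \<beta> * w2"
  note loc = localization_add[OF p] localization_mult[OF p] localization_diff[OF p]
  have rs: "r1 \<in> localization_at p" "r2 \<in> localization_at p"
    "s1 \<in> localization_at p" "s2 \<in> localization_at p"
    unfolding r1_def r2_def s1_def s2_def w1_def w2_def \<alpha>_def \<beta>_def
    by (intro log_derivative_mod_localization assms)+
  have ab: "\<alpha> \<in> localization_at p" "\<beta> \<in> localization_at p" "P \<in> localization_at p"
    "D1 P \<in> localization_at p" "D2 P \<in> localization_at p"
    using of_int_in_localization to_fract_in_localization[OF p] D1(2)[of p] D2(2)[of p]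
    by (auto simp: \<alpha>_def \<beta>_def P_def)
  have Dg: "D1 g = g * (\<alpha> * w1 + r1)" "D2 g = g * (\<alpha> * w2 + r2)"
    "D1 h = h * (\<beta> * w1 + s1)" "D2 h = h * (\<beta> * w2 + s2)"
    using \<open>g \<noteq> 0\<close> \<open>h \<noteq> 0\<close> by (simp_all add: r1_def r2_def s1_def s2_def)
  have Pw: "P * w1 = D1 P" "P * w2 = D2 P"
    using \<open>P \<noteq> 0\<close> by (simp_all add: w1_def w2_def)
  \<comment> \<open>After expansion the two terms with \<open>\<alpha> * \<beta> * w1 * w2\<close>
    cancel; every other term has at most one factor \<open>w1\<close> or \<open>w2\<close>, so a
    single \<open>P\<close> clears it.\<close>
  have "P * J = g * h * (\<alpha> * ((P * w1) * s2 - (P * w2) * s1)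
      + \<beta> * (r1 * (P * w2) - r2 * (P * w1)) + P * (r1 * s2 - r2 * s1))"
    unfolding J_def Dg by (simp add: algebra_simps)
  also have "\<dots> = g * h * (\<alpha> * (D1 P * s2 - D2 P * s1)
      + \<beta> * (r1 * D2 P - r2 * D1 P) + P * (r1 * s2 - r2 * s1))" (is "_ = g * h * ?R")
    unfolding Pw ..
  finally have eq: "P * J = g * h * ?R" .
  have "?R \<in> localization_at p"
    using rs ab by (intro loc)
  moreover have nz: "?R \<noteq> 0"
    using eq J \<open>P \<noteq> 0\<close> by (auto simp: J_def)
  ultimately have "ord_at p ?R \<ge> 0"
    using localization_iff_ord_at[OF p] by blast
  moreover have "ord_at p (P * J) = ord_at p P + ord_at p J"
    using J \<open>P \<noteq> 0\<close> by (intro ord_at_mult[OF p]) (auto simp: J_def)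
  moreover have "ord_at p (g * h * ?R) = ord_at p g + ord_at p h + ord_at p ?R"
    using nz \<open>g \<noteq> 0\<close> \<open>h \<noteq> 0\<close> by (simp add: ord_at_mult[OF p])
  moreover have "ord_at p P = 1"
    using ord_at_powi[OF p, of 1] by (simp add: P_def)
  ultimately show ?thesis
    using eq unfolding J_def by simp
qed

end

section \<open>Linear forms\<close>

lemma scalar2_simps:
  "scalar2 (x + y) = scalar2 x + scalar2 y" "scalar2 (x - y) = scalar2 x - scalar2 y"
  "scalar2 (- x) = - scalar2 x" "scalar2 (x * y) = scalar2 x * scalar2 y"
  "scalar2 0 = 0" "scalar2 1 = 1"
  by (simp_all add: scalar2_def)

lemma scalar2_eq_iff [simp]: "scalar2 x = scalar2 y \<longleftrightarrow> x = y"
  by (simp add: scalar2_def)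

lemma scalar2_eq_0_iff [simp]: "scalar2 x = 0 \<longleftrightarrow> x = 0"
  by (simp add: scalar2_def)

lemma is_unit_scalar2: "u \<noteq> 0 \<Longrightarrow> scalar2 u dvd 1"
  by (metis dvdI right_inverse scalar2_simps(4,6))

lemma prime_elem_not_dvd_scalar2:
  assumes "prime_elem p" "u \<noteq> 0"
  shows "\<not> p dvd scalar2 u"
proof
  assume "p dvd scalar2 u"
  then have "p dvd 1"
    using is_unit_scalar2[OF assms(2)] by (rule dvd_trans)
  then show False
    using assms(1) by (simp add: prime_elem_def)
qed

lemma is_unit_iff_scalar2: "p dvd 1 \<longleftrightarrow> (\<exists>u. u \<noteq> 0 \<and> p = scalar2 u)"
proof
  assume "p dvd 1"
  then show "\<exists>u. u \<noteq> 0 \<and> p = scalar2 u"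
    by (auto simp: is_unit_poly_iff scalar2_def elim!: degree_eq_zeroE)
qed (auto intro: is_unit_scalar2)

definition linform :: "'k::field \<Rightarrow> 'k \<Rightarrow> 'k \<Rightarrow> 'k poly poly" where
  "linform a b c = scalar2 a * var_x + scalar2 b * var_y + scalar2 c"

lemma linform_pCons: "linform a b c = [:[:c, a:], [:b:]:]"
  by (simp add: linform_def scalar2_def var_x_def var_y_def)

lemma linform_eq_iff [simp]: "linform a b c = linform a' b' c' \<longleftrightarrow> a = a' \<and> b = b' \<and> c = c'"
  by (auto simp: linform_pCons)

lemma scalar2_conv_linform: "scalar2 c = linform 0 0 c"
  by (simp add: linform_def scalar2_simps)

lemma linear_form2_iff:
  "linear_form2 l \<longleftrightarrow> (\<exists>a b c. l = linform a b c \<and> (a \<noteq> 0 \<or> b \<noteq> 0))"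
  unfolding linear_form2_def linform_def[symmetric]
  by (auto simp: scalar2_conv_linform image_iff)

lemma pdx_poly_scalar2: "pdx_poly (scalar2 c) = 0"
  and pdy_poly_scalar2: "pdy_poly (scalar2 c) = 0"
  by (simp_all add: poly_eq_iff coeff_pdx_poly pdy_poly_def scalar2_def coeff_pCons pderiv_pCons
      split: nat.split)

lemma pdx_poly_linform: "pdx_poly (linform a b c) = scalar2 a"
  and pdy_poly_linform: "pdy_poly (linform a b c) = scalar2 b"
  by (simp_all add: poly_eq_iff coeff_pdx_poly pdy_poly_def scalar2_def linform_pCons coeff_pCons
      pderiv_pCons split: nat.split)

text \<open>If \<open>b\<close> is nonzero, the form has degree one in y, and a factor free of y
  divides the leading coefficient, a unit. If \<open>b = 0\<close>, both factors are polynomials in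
  x alone, and one of them has degree 0.\<close>

lemma irreducible_linform:
  fixes a b c :: "'k::field"
  assumes "a \<noteq> 0 \<or> b \<noteq> 0"
  shows "irreducible (linform a b c)"
proof (rule irreducibleI)
  show "linform a b c \<noteq> 0"
    using assms by (auto simp: linform_pCons)
  show "\<not> linform a b c dvd 1"
    using assms by (auto simp: is_unit_iff_scalar2 scalar2_conv_linform)
  fix p q assume pq: "linform a b c = p * q"
  have nz: "p \<noteq> 0" "q \<noteq> 0"
    using \<open>linform a b c \<noteq> 0\<close> pq by auto
  have deg: "degree p + degree q = degree (linform a b c)"
    using nz by (simp add: pq degree_mult_eq)
  show "p dvd 1 \<or> q dvd 1"
  proof (cases "b = 0")
    case False
    have unit: "p dvd 1" if "linform a b c = p * q" "degree p = 0" for p q :: "'k poly poly"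
    proof -
      obtain p0 where "p = [:p0:]"
        using \<open>degree p = 0\<close> by (metis degree_eq_zeroE)
      then have "[:b:] = p0 * coeff q 1"
        using arg_cong[OF that(1), of "\<lambda>p. coeff p 1"] by (simp add: linform_pCons)
      moreover have "[:b:] dvd 1"
        using False by (simp add: is_unit_poly_iff dvd_field_iff)
      ultimately have "p0 dvd 1"
        by (metis dvd_mult_left)
      then show ?thesis
        using \<open>p = [:p0:]\<close> by (simp add: is_unit_poly_iff)
    qed
    have "degree p = 0 \<or> degree q = 0"
      using deg False by (auto simp: linform_pCons)
    then show ?thesis
      using unit[of p q] unit[of q p] pq by (auto simp: mult.commute)
  next
    case True
    then have "degree p = 0" "degree q = 0"
      using deg by (auto simp: linform_pCons)
    then obtain p0 q0 where p0: "p = [:p0:]" "q = [:q0:]"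
      by (metis degree_eq_zeroE)
    then have eq: "[:c, a:] = p0 * q0"
      using pq True by (simp add: linform_pCons)
    then have "degree p0 + degree q0 = 1"
      using nz p0 assms True by (metis degree_mult_eq degree_pCons_eq_if pCons_eq_0_iff degree_0 One_nat_def)
    then have "degree p0 = 0 \<or> degree q0 = 0"
      by linarith
    then show ?thesis
      using nz p0 by (auto simp: is_unit_poly_iff dvd_field_iff elim!: degree_eq_zeroE)
  qed
qed

text \<open>If the determinant vanished, both forms would lie in the kernel of the derivation
  \<open>b\<close> d/dx - \<open>a\<close> d/dy. This kernel is a subalgebra, so it would contain x
  and y, forcing \<open>a = b = 0\<close>.\<close>

lemma generates2_linforms_imp_det:
  fixes a b c :: "'k::field"
  assumes gen: "generates2 {linform a b c, linform a' b' c'}" and "a \<noteq> 0 \<or> b \<noteq> 0"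
  shows "a * b' - a' * b \<noteq> 0"
proof
  assume det: "a * b' - a' * b = 0"
  define A where "A = {p. scalar2 b * pdx_poly p = scalar2 a * pdy_poly p}"
  have "subalgebra2 A"
    unfolding subalgebra2_def A_def
    by (auto simp: pdx_poly_scalar2 pdy_poly_scalar2 pdx_poly_mult pdy_poly_mult
        derivation_add[OF derivation_pdx_poly] derivation_add[OF derivation_pdy_poly]
        distrib_left mult.assoc[symmetric])
  moreover have "{linform a b c, linform a' b' c'} \<subseteq> A"
    using det by (auto simp: A_def pdx_poly_linform pdy_poly_linform scalar2_simps(4)[symmetric] mult_ac)
  ultimately have "A = UNIV"
    using gen hull_minimal[of _ A subalgebra2] unfolding generates2_def
    by (metis top.extremum_uniqueI)
  then have "linform 1 0 0 \<in> A" "linform 0 1 0 \<in> A"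
    by auto
  then show False
    using assms(2) by (auto simp: A_def pdx_poly_linform pdy_poly_linform scalar2_simps)
qed

text \<open>The bracket with {x,y} = 1. Separating it from the factor \<open>f\<close> allows the
  order of each to be bounded on its own.\<close>

definition jacobian :: "'k::field poly poly fract \<Rightarrow> 'k poly poly fract \<Rightarrow> 'k poly poly fract" where
  "jacobian g h = pdx g * pdy h - pdy g * pdx h"

lemma poisson_bracket_jacobian: "poisson_bracket f g h = jacobian g h * f"
  by (simp add: poisson_bracket_def jacobian_def)

lemma jacobian_linform:
  "jacobian (to_fract (linform a b c)) (to_fract (linform a' b' c')) = to_fract (scalar2 (a * b' - a' * b))"
  by (simp add: jacobian_def pdx_to_fract pdy_to_fract pdx_poly_linform pdy_poly_linform
      scalar2_simps mult.commute)

lemma ord_at_jacobian_ge: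
  assumes "prime_elem p" "g \<noteq> 0" "h \<noteq> 0" "jacobian g h \<noteq> 0"
  shows "ord_at p (jacobian g h) \<ge> ord_at p g + ord_at p h - 1"
  using assms ord_at_jacobian[OF assms(1) derivation_pdx _ derivation_pdy]
  by (simp add: jacobian_def pdx_to_fract pdy_to_fract)

text \<open>The hypotheses in coordinates: generation of the algebra enters as a nonzero determinant
  of linear parts, which \<open>generates2_linforms_imp_det\<close> supplies.\<close>

locale line_arrangement =
  fixes l :: "nat \<Rightarrow> 'k::field poly poly" and n :: nat and a b c :: "nat \<Rightarrow> 'k"
    and f :: "'k poly poly"
  assumes n_ge_4: "n \<ge> 4"
    and f_def: "f = (\<Prod>i\<in>{1..n}. l i)"
    and l_linform: "i \<in> {1..n} \<Longrightarrow> l i = linform (a i) (b i) (c i)"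
    and nonconstant: "i \<in> {1..n} \<Longrightarrow> a i \<noteq> 0 \<or> b i \<noteq> 0"
    and not_associated:
      "i \<in> {1..n} \<Longrightarrow> j \<in> {1..n} \<Longrightarrow> i \<noteq> j \<Longrightarrow> u \<noteq> 0 \<Longrightarrow> l i \<noteq> scalar2 u * l j"
    and three_transversal: "i \<in> {1..n} \<Longrightarrow> card {j \<in> {1..n}. a i * b j - a j * b i \<noteq> 0} \<ge> 3"
begin

definition det :: "nat \<Rightarrow> nat \<Rightarrow> 'k" where
  "det i j = a i * b j - a j * b i"

lemma irreducible_line: "i \<in> {1..n} \<Longrightarrow> irreducible (l i)"
  using irreducible_linform nonconstant l_linform by metis

lemma line_nonzero: "i \<in> {1..n} \<Longrightarrow> l i \<noteq> 0"
  using irreducible_line by (auto simp: irreducible_def)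

lemma f_nonzero: "f \<noteq> 0"
  using line_nonzero by (simp add: f_def)

text \<open>Cramer's rule for two lines; the determinant stays on the left, so the identity is one
  of polynomials without division.\<close>

lemma var_x_conv_lines:
  assumes "i \<in> {1..n}" "j \<in> {1..n}"
  shows "scalar2 (det i j) * var_x =
    scalar2 (b j) * l i + scalar2 (- b i) * l j + scalar2 (b i * c j - b j * c i)"
  using assms by (simp add: l_linform linform_def det_def scalar2_simps algebra_simps)

lemma var_y_conv_lines:
  assumes "i \<in> {1..n}" "j \<in> {1..n}"
  shows "scalar2 (det i j) * var_y =
    scalar2 (- a j) * l i + scalar2 (a i) * l j + scalar2 (a j * c i - a i * c j)"
  using assms by (simp add: l_linform linform_def det_def scalar2_simps algebra_simps)

text \<open>The linear parts are proportional, with \<open>u\<close> read off from a nonzero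
  coefficient of line \<open>i\<close>. If the constant \<open>v\<close> were 0, the two forms would
  be associated.\<close>

lemma parallel_lines:
  assumes "i \<in> {1..n}" "j \<in> {1..n}" "i \<noteq> j" "det i j = 0"
  obtains u v where "v \<noteq> 0" "l j = scalar2 u * l i + scalar2 v"
proof -
  define u where "u = (if a i \<noteq> 0 then a j / a i else b j / b i)"
  define v where "v = c j - u * c i"
  have *: "a j = u * a i" "b j = u * b i"
    using assms(4) nonconstant[OF assms(1)] by (auto simp: u_def det_def field_simps)
  then have eq: "l j = scalar2 u * l i + scalar2 v"
    using assms by (simp add: l_linform linform_def v_def scalar2_simps algebra_simps)
  have "u \<noteq> 0"
    using * nonconstant[OF assms(2)] by auto
  have "v \<noteq> 0"
    using not_associated[OF assms(2,1) assms(3)[symmetric] \<open>u \<noteq> 0\<close>] eq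
    by (metis add.right_neutral scalar2_simps(5))
  then show ?thesis
    using that eq by blast
qed

end

section \<open>Automorphisms preserve the polynomial ring\<close>

abbreviation const :: "'k::field \<Rightarrow> 'k poly poly fract" where
  "const c \<equiv> to_fract (scalar2 c)"

lemma poly_poly_induct [case_names scalar var_x var_y add mult]:
  fixes p :: "'k::field poly poly"
  assumes "\<And>c. P (scalar2 c)" "P var_x" "P var_y"
    and add: "\<And>p q. P p \<Longrightarrow> P q \<Longrightarrow> P (p + q)" and mult: "\<And>p q. P p \<Longrightarrow> P q \<Longrightarrow> P (p * q)"
  shows "P p"
proof (induction p)
  case 0
  show ?case
    using assms(1)[of 0] by (simp add: scalar2_simps)
next
  case (pCons q p)
  have "P [:q:]" for q
  proof (induction q)
    case 0
    show ?case
      using assms(1)[of 0] by (simp add: scalar2_simps)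
  next
    case (pCons c q)
    have "[:pCons c q:] = scalar2 c + var_x * [:q:]"
      by (simp add: scalar2_def var_x_def)
    then show ?case
      using pCons assms by metis
  qed
  moreover have "pCons q p = [:q:] + var_y * p"
    by (simp add: var_y_def)
  ultimately show ?case
    using pCons assms by metis
qed

locale poisson_aut =
  fixes f :: "'k::field poly poly" and \<phi> :: "'k poly poly fract \<Rightarrow> 'k poly poly fract"
  assumes aut: "poisson_automorphism (to_fract f) \<phi>"
begin

lemma aut_bij: "bij \<phi>"
  and aut_one [simp]: "\<phi> 1 = 1"
  and aut_add [simp]: "\<phi> (g + h) = \<phi> g + \<phi> h"
  and aut_mult [simp]: "\<phi> (g * h) = \<phi> g * \<phi> h"
  and aut_const [simp]: "\<phi> (const c) = const c"
  using aut by (auto simp: poisson_automorphism_def)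

lemma aut_zero [simp]: "\<phi> 0 = 0"
  using aut_const[of 0] by (simp add: scalar2_simps)

lemma aut_eq_iff [simp]: "\<phi> g = \<phi> h \<longleftrightarrow> g = h"
  using aut_bij by (auto simp: bij_def inj_eq)

lemma aut_eq_0_iff [simp]: "\<phi> g = 0 \<longleftrightarrow> g = 0"
  using aut_eq_iff[of g 0] by simp

lemma aut_prod: "\<phi> (\<Prod>i\<in>A. g i) = (\<Prod>i\<in>A. \<phi> (g i))"
  by (induction A rule: infinite_finite_induct) simp_all

lemma jacobian_image: "\<phi> (jacobian g h) * \<phi> (to_fract f) = jacobian (\<phi> g) (\<phi> h) * to_fract f"
  using aut by (simp add: poisson_automorphism_def poisson_bracket_jacobian)

lemma inverse_automorphism: "poisson_automorphism (to_fract f) (inv_into UNIV \<phi>)"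
proof -
  note surj = bij_is_surj[OF aut_bij]
  have inv: "\<phi> (inv_into UNIV \<phi> g) = g" for g
    by (rule surj_f_inv_f[OF surj])
  have eqI: "inv_into UNIV \<phi> g = h" if "\<phi> h = g" for g h
    using inv[of g] that by (metis aut_eq_iff)
  have "\<phi> (poisson_bracket (to_fract f) g h) = poisson_bracket (to_fract f) (\<phi> g) (\<phi> h)" for g h
    using aut by (simp add: poisson_automorphism_def)
  then show ?thesis
    unfolding poisson_automorphism_def
    by (intro conjI allI bij_imp_bij_inv[OF aut_bij] eqI) (simp_all add: inv)
qed

lemma polynomial_image:
  assumes "\<phi> (to_fract var_x) \<in> range to_fract" "\<phi> (to_fract var_y) \<in> range to_fract"
  shows "\<phi> (to_fract p) \<in> range to_fract"
proof (induction p rule: poly_poly_induct)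
  case (scalar c)
  show ?case
    unfolding aut_const by (rule rangeI)
next
  case (add p q)
  then obtain p' q' where "\<phi> (to_fract p) = to_fract p'" "\<phi> (to_fract q) = to_fract q'"
    by blast
  then have "\<phi> (to_fract (p + q)) = to_fract (p' + q')"
    by simp
  then show ?case
    by blast
next
  case (mult p q)
  then obtain p' q' where "\<phi> (to_fract p) = to_fract p'" "\<phi> (to_fract q) = to_fract q'"
    by blast
  then have "\<phi> (to_fract (p * q)) = to_fract (p' * q')"
    by simp
  then show ?case
    by blast
qed (rule assms)+

end

locale line_arrangement_automorphism =
  line_arrangement l n a b c f + poisson_aut f \<phi>
  for l :: "nat \<Rightarrow> 'k::field poly poly" and n a b c f \<phi>
begin

text \<open>Two lines have a constant Jacobian, which \<open>\<phi>\<close> fixes, so the bracket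
  condition for them becomes this identity. It is exploited three times: for poles, for divisibility
  by a line, and for the scaling factor.\<close>

lemma transversal_jacobian:
  assumes "i \<in> {1..n}" "j \<in> {1..n}"
  shows "const (det i j) * (\<Prod>k\<in>{1..n}. \<phi> (to_fract (l k)))
    = jacobian (\<phi> (to_fract (l i))) (\<phi> (to_fract (l j))) * to_fract f"
proof -
  have "to_fract f = (\<Prod>k\<in>{1..n}. to_fract (l k))"
    by (simp add: f_def to_fract_hom.hom_prod)
  then have "\<phi> (to_fract f) = (\<Prod>k\<in>{1..n}. \<phi> (to_fract (l k)))"
    by (simp only: aut_prod)
  then show ?thesis
    using jacobian_image[of "to_fract (l i)" "to_fract (l j)"] assms
    by (simp add: l_linform jacobian_linform det_def)
qed

text \<open>
  A common pole of order \<open>m\<close> of \<open>\<phi> x\<close> and \<open>\<phi> y\<close> along \<open>p\<close> is also a pole of order \<open>m\<close> of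
  \<open>\<phi> l\<^sub>j\<close> for all lines \<open>l\<^sub>j\<close> transversal to the line \<open>l\<^sub>i\<close> whose image has maximal order \<open>t\<close>.
  The three transversal lines give \<open>\<phi> f\<close> order at most \<open>t - 3 m\<close>, whereas the Jacobian of
  \<open>\<phi> l\<^sub>i\<close> and \<open>\<phi> l\<^sub>j\<close> has order at least \<open>t - m - 1\<close>.
\<close>

lemma image_in_localization:
  assumes p: "prime_elem p"
  shows "\<phi> (to_fract var_x) \<in> localization_at p \<and> \<phi> (to_fract var_y) \<in> localization_at p"
proof (rule ccontr)
  define X Y where "X = \<phi> (to_fract var_x)" and "Y = \<phi> (to_fract var_y)"
  define L where "L i = \<phi> (to_fract (l i))" for i
  assume "\<not> (\<phi> (to_fract var_x) \<in> localization_at p \<and> \<phi> (to_fract var_y) \<in> localization_at p)"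
  then have pole: "\<not> (X \<in> localization_at p \<and> Y \<in> localization_at p)"
    by (simp add: X_def Y_def)
  have "X \<noteq> 0" "Y \<noteq> 0"
    by (simp_all add: X_def Y_def var_x_def var_y_def)
  have L_nz: "L i \<noteq> 0" if "i \<in> {1..n}" for i
    using line_nonzero[OF that] by (simp add: L_def)
  \<comment> \<open>The larger of the two pole orders; it is positive as soon as \<open>X\<close> or
    \<open>Y\<close> has a pole.\<close>
  define m where "m = - min (ord_at p X) (ord_at p Y)"
  have "m \<ge> 1"
    using pole localization_iff_ord_at[OF p] \<open>X \<noteq> 0\<close> \<open>Y \<noteq> 0\<close> by (auto simp: m_def)
  have const_ge: "ord_ge p k (const u)" if "k \<le> 0" for k u
    using ord_ge_to_fract[OF p that] .
  have const_mult: "ord_ge p k (const u * g)" if "ord_ge p k g" for k u g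
    using ord_ge_mult[OF p to_fract_in_localization[OF p] that] .
  have XY: "ord_ge p (- m) X" "ord_ge p (- m) Y"
    using ord_ge_iff[OF p] \<open>X \<noteq> 0\<close> \<open>Y \<noteq> 0\<close> by (auto simp: m_def)
  have L: "L i = const (a i) * X + const (b i) * Y + const (c i)" if "i \<in> {1..n}" for i
    using that by (simp add: L_def X_def Y_def l_linform linform_def)
  have L_lower: "ord_at p (L i) \<ge> - m" if "i \<in> {1..n}" for i
  proof -
    have "ord_ge p (- m) (L i)"
      using \<open>m \<ge> 1\<close> XY unfolding L[OF that]
      by (intro ord_ge_add[OF p] const_mult const_ge) auto
    then show ?thesis
      using ord_ge_iff[OF p L_nz[OF that]] by simp
  qed
  \<comment> \<open>Cramer's rule expresses \<open>X\<close> and \<open>Y\<close> by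
    \<open>L i\<close>, \<open>L j\<close> and constants. Since 1 - m \<le> 0, constants satisfy the
    bound, so both \<open>X\<close> and \<open>Y\<close> would have order at least 1 - m, against
    the choice of \<open>m\<close>.\<close>
  have not_both: "\<not> (ord_at p (L i) \<ge> 1 - m \<and> ord_at p (L j) \<ge> 1 - m)"
    if ij: "i \<in> {1..n}" "j \<in> {1..n}" "det i j \<noteq> 0" for i j
  proof
    assume "ord_at p (L i) \<ge> 1 - m \<and> ord_at p (L j) \<ge> 1 - m"
    then have ge: "ord_ge p (1 - m) (L i)" "ord_ge p (1 - m) (L j)"
      using ord_ge_iff[OF p] L_nz ij by auto
    have inv: "const (1 / det i j) * (const (det i j) * g) = g" for g
      using ij(3) by (simp add: mult.assoc[symmetric] to_fract_mult[symmetric]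
          scalar2_simps(4)[symmetric] scalar2_simps(6) del: to_fract_mult to_fract_hom.hom_mult)
    have "const (det i j) * X = const (b j) * L i + const (- b i) * L j + const (b i * c j - b j * c i)"
      using arg_cong[OF var_x_conv_lines[OF ij(1,2)], of "\<lambda>p. \<phi> (to_fract p)"]
      by (simp add: X_def L_def)
    then have "ord_ge p (1 - m) (const (det i j) * X)"
      using ge \<open>m \<ge> 1\<close> by (simp only:) (intro ord_ge_add[OF p] const_mult const_ge; simp)
    then have "ord_ge p (1 - m) X"
      using const_mult[of "1 - m" "const (det i j) * X" "1 / det i j"] by (simp only: inv)
    moreover have "const (det i j) * Y = const (- a j) * L i + const (a i) * L j + const (a j * c i - a i * c j)"
      using arg_cong[OF var_y_conv_lines[OF ij(1,2)], of "\<lambda>p. \<phi> (to_fract p)"]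
      by (simp add: Y_def L_def)
    then have "ord_ge p (1 - m) (const (det i j) * Y)"
      using ge \<open>m \<ge> 1\<close> by (simp only:) (intro ord_ge_add[OF p] const_mult const_ge; simp)
    then have "ord_ge p (1 - m) Y"
      using const_mult[of "1 - m" "const (det i j) * Y" "1 / det i j"] by (simp only: inv)
    ultimately show False
      using ord_ge_iff[OF p] \<open>X \<noteq> 0\<close> \<open>Y \<noteq> 0\<close> by (auto simp: m_def)
  qed
  define t where "t = Max ((\<lambda>i. ord_at p (L i)) ` {1..n})"
  have "t \<in> (\<lambda>i. ord_at p (L i)) ` {1..n}"
    unfolding t_def using n_ge_4 by (intro Max_in) auto
  then obtain i where i: "i \<in> {1..n}" "ord_at p (L i) = t"
    by auto
  have t_max: "ord_at p (L j) \<le> t" if "j \<in> {1..n}" for j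
    unfolding t_def using that by (intro Max_ge) auto
  define N where "N = {j \<in> {1..n}. det i j \<noteq> 0}"
  have "card N \<ge> 3"
    using three_transversal[OF i(1)] by (simp add: N_def det_def)
  have N_sub: "N \<subseteq> {1..n}" "i \<notin> N"
    by (auto simp: N_def det_def)
  \<comment> \<open>If the order of \<open>L j\<close> were above - m, so would be the maximum
    \<open>t\<close>, the order of \<open>L i\<close>; \<open>not_both\<close> excludes
    this.\<close>
  have ord_N: "ord_at p (L j) = - m" if "j \<in> N" for j
    using that not_both[of i j] i t_max[of j] L_lower[of j] by (auto simp: N_def)
  \<comment> \<open>If \<open>L j\<close> had positive order, so would \<open>L i\<close> by
    maximality of \<open>t\<close>. But a combination of the two is a nonzero constant, which has
    order 0.\<close>
  have ord_parallel: "ord_at p (L j) \<le> 0" if "j \<in> {1..n} - N - {i}" for j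
  proof (rule ccontr)
    assume "\<not> ord_at p (L j) \<le> 0"
    then have pos: "ord_ge p 1 (L j)" "ord_ge p 1 (L i)"
      using that i t_max[of j] ord_ge_iff[OF p] L_nz by auto
    have "j \<in> {1..n}" "i \<noteq> j" "det i j = 0"
      using that by (auto simp: N_def)
    then obtain u v where uv: "v \<noteq> 0" "l j = scalar2 u * l i + scalar2 v"
      by (rule parallel_lines[OF i(1)])
    then have "const v = L j + const (- u) * L i"
      by (simp add: L_def scalar2_simps)
    then have "ord_ge p 1 (const v)"
      using pos by (simp only:) (intro ord_ge_add[OF p] const_mult)
    then show False
      using ord_ge_iff[OF p] ord_at_unit[OF p is_unit_scalar2[OF uv(1)]] uv(1) by auto
  qed
  have split: "{1..n} = insert i (N \<union> ({1..n} - N - {i}))" and fin: "finite N"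
    using i(1) N_sub finite_subset by auto
  have "(\<Sum>j\<in>{1..n}. ord_at p (L j))
      = ord_at p (L i) + (\<Sum>j\<in>N \<union> ({1..n} - N - {i}). ord_at p (L j))"
    using N_sub(2) fin by (subst split, subst sum.insert) auto
  also have "\<dots> = t + ((\<Sum>j\<in>N. ord_at p (L j)) + (\<Sum>j\<in>{1..n} - N - {i}. ord_at p (L j)))"
    using fin i(2) by (subst sum.union_disjoint) auto
  finally have "(\<Sum>j\<in>{1..n}. ord_at p (L j))
      = t + ((\<Sum>j\<in>N. ord_at p (L j)) + (\<Sum>j\<in>{1..n} - N - {i}. ord_at p (L j)))" .
  moreover have "(\<Sum>j\<in>N. ord_at p (L j)) = - m * int (card N)"
    using ord_N by simp
  moreover have "(\<Sum>j\<in>{1..n} - N - {i}. ord_at p (L j)) \<le> 0"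
    using ord_parallel by (intro sum_nonpos) auto
  moreover have "- m * int (card N) \<le> - 3 * m"
    using \<open>card N \<ge> 3\<close> \<open>m \<ge> 1\<close> mult_left_mono[of 3 "int (card N)" m] by simp
  ultimately have upper: "(\<Sum>j\<in>{1..n}. ord_at p (L j)) \<le> t - 3 * m"
    by linarith
  obtain j where j: "j \<in> N"
    using \<open>card N \<ge> 3\<close> by fastforce
  then have "det i j \<noteq> 0" "j \<in> {1..n}"
    by (auto simp: N_def)
  note eq = transversal_jacobian[OF i(1) \<open>j \<in> {1..n}\<close>, folded L_def]
  have "(\<Prod>k\<in>{1..n}. L k) \<noteq> 0"
    using L_nz by simp
  then have J_nz: "jacobian (L i) (L j) \<noteq> 0"
    using eq \<open>det i j \<noteq> 0\<close> by auto
  have "ord_at p (\<Prod>k\<in>{1..n}. L k) = (\<Sum>k\<in>{1..n}. ord_at p (L k))"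
    by (rule ord_at_prod[OF p]) (use L_nz in auto)
  then have "ord_at p (const (det i j) * (\<Prod>k\<in>{1..n}. L k)) = (\<Sum>k\<in>{1..n}. ord_at p (L k))"
    using \<open>det i j \<noteq> 0\<close> \<open>(\<Prod>k\<in>{1..n}. L k) \<noteq> 0\<close>
    by (subst ord_at_mult[OF p]) (simp_all add: ord_at_unit[OF p] is_unit_scalar2)
  moreover have "ord_at p (jacobian (L i) (L j) * to_fract f)
      = ord_at p (jacobian (L i) (L j)) + ord_at p (to_fract f)"
    using J_nz f_nonzero by (simp add: ord_at_mult[OF p])
  moreover have "ord_at p (jacobian (L i) (L j)) \<ge> t - m - 1"
    using ord_at_jacobian_ge[OF p L_nz[OF i(1)] L_nz[OF \<open>j \<in> {1..n}\<close>] J_nz] i(2) ord_N[OF j]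
    by simp
  moreover have "ord_at p (to_fract f) \<ge> 0"
    using localization_iff_ord_at[OF p, of "to_fract f"] to_fract_in_localization[OF p, of f] f_nonzero
    by (simp del: to_fract_in_localization)
  \<comment> \<open>The two estimates give t - m - 1 \<le> t - 3 m, that is 2 m \<le> 1.\<close>
  ultimately show False
    using arg_cong[OF eq, of "ord_at p"] upper \<open>m \<ge> 1\<close> by linarith
qed

lemma polynomial: "\<phi> (to_fract p) \<in> range to_fract"
  by (rule polynomial_image; rule in_range_to_fractI; simp add: image_in_localization)

end

section \<open>The permutation of the lines\<close>

context line_arrangement
begin

lemma line_arrangement_automorphism_iff:
  "line_arrangement_automorphism l n a b c f \<phi> \<longleftrightarrow> poisson_automorphism (to_fract f) \<phi>"
  by (simp add: line_arrangement_automorphism_def poisson_aut_def line_arrangement_axioms)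

lemma associated_lines_eq:
  assumes "i \<in> {1..n}" "j \<in> {1..n}" "u \<noteq> 0" "v \<noteq> 0"
    and "const u * to_fract (l i) = const v * to_fract (l j)"
  shows "i = j"
proof (rule ccontr)
  assume "i \<noteq> j"
  have "to_fract (scalar2 u * l i) = to_fract (scalar2 v * l j)"
    using assms(5) by simp
  then have "scalar2 u * l i = scalar2 v * l j"
    by (simp only: to_fract_eq_iff)
  then have "scalar2 (1 / u) * (scalar2 u * l i) = scalar2 (1 / u) * (scalar2 v * l j)"
    by simp
  then have "l i = scalar2 (v / u) * l j"
    using \<open>u \<noteq> 0\<close> by (simp add: mult.assoc[symmetric] scalar2_simps(4)[symmetric] scalar2_simps(6))
  then show False
    using not_associated[OF assms(1,2) \<open>i \<noteq> j\<close>, of "v / u"] assms(3,4) by simp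
qed

text \<open>Elements of \<open>sym_group n\<close> are permutations of all natural numbers that fix
  everything outside \<open>{1..n}\<close>, hence the identity there. For indices of lines the
  choice is unique because distinct lines are not associated.\<close>

definition line_perm :: "('k poly poly fract \<Rightarrow> 'k poly poly fract) \<Rightarrow> nat \<Rightarrow> nat" where
  "line_perm \<phi> i = (if i \<in> {1..n}
     then THE j. j \<in> {1..n} \<and> (\<exists>u. u \<noteq> 0 \<and> \<phi> (to_fract (l i)) = const u * to_fract (l j)) else i)"

lemma line_perm_outside: "i \<notin> {1..n} \<Longrightarrow> line_perm \<phi> i = i"
  unfolding line_perm_def by (rule if_not_P)

lemma line_perm_eqI:
  assumes "i \<in> {1..n}" "j \<in> {1..n}" "u \<noteq> 0" "\<phi> (to_fract (l i)) = const u * to_fract (l j)"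
  shows "line_perm \<phi> i = j"
proof -
  have "(THE j. j \<in> {1..n} \<and> (\<exists>u. u \<noteq> 0 \<and> \<phi> (to_fract (l i)) = const u * to_fract (l j))) = j"
  proof (rule the_equality)
    show "j \<in> {1..n} \<and> (\<exists>u. u \<noteq> 0 \<and> \<phi> (to_fract (l i)) = const u * to_fract (l j))"
      using assms by blast
    fix k assume "k \<in> {1..n} \<and> (\<exists>v. v \<noteq> 0 \<and> \<phi> (to_fract (l i)) = const v * to_fract (l k))"
    then obtain v where v: "k \<in> {1..n}" "v \<noteq> 0" "\<phi> (to_fract (l i)) = const v * to_fract (l k)"
      by (elim conjE exE)
    show "k = j"
      by (rule associated_lines_eq[OF v(1) assms(2) v(2) assms(3)]) (simp only: v(3)[symmetric] assms(4))
  qed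
  then show ?thesis
    unfolding line_perm_def using assms(1) by (simp only: if_True)
qed

lemma exists_transversal:
  assumes "i \<in> {1..n}"
  obtains j where "j \<in> {1..n}" "det i j \<noteq> 0"
proof -
  have "{j \<in> {1..n}. a i * b j - a j * b i \<noteq> 0} \<noteq> {}"
  proof
    assume "{j \<in> {1..n}. a i * b j - a j * b i \<noteq> 0} = {}"
    then show False
      using three_transversal[OF assms] by (simp only: card.empty)
  qed
  then obtain j where "j \<in> {1..n}" "a i * b j - a j * b i \<noteq> 0"
    by blast
  then show ?thesis
    using that by (simp add: det_def)
qed

end

context line_arrangement_automorphism
begin

lemma inverse: "line_arrangement_automorphism l n a b c f (inv_into UNIV \<phi>)"
  using inverse_automorphism line_arrangement_automorphism_iff by blast

text \<open>The line \<open>l i\<close> divides \<open>f\<close>, hence the product of the images of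
  all lines, hence the image of one line \<open>l k\<close>. As \<open>\<phi>\<close> and its
  inverse both act on polynomials, that image is irreducible, and its cofactor is a
  constant.\<close>

lemma line_preimage:
  assumes i: "i \<in> {1..n}"
  shows "\<exists>j\<in>{1..n}. \<exists>u. u \<noteq> 0 \<and> \<phi> (to_fract (l j)) = const u * to_fract (l i)"
proof -
  interpret inverse: line_arrangement_automorphism l n a b c f "inv_into UNIV \<phi>"
    by (rule inverse)
  have \<phi>_inv: "\<phi> (inv_into UNIV \<phi> g) = g" for g
    by (rule surj_f_inv_f[OF bij_is_surj[OF aut_bij]])
  have "\<forall>p. \<exists>q. \<phi> (to_fract p) = to_fract q"
    using polynomial by blast
  then obtain \<psi> where \<psi>: "\<And>p. \<phi> (to_fract p) = to_fract (\<psi> p)"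
    by metis
  have "\<forall>p. \<exists>q. inv_into UNIV \<phi> (to_fract p) = to_fract q"
    using inverse.polynomial by blast
  then obtain \<psi>' where \<psi>': "\<And>p. inv_into UNIV \<phi> (to_fract p) = to_fract (\<psi>' p)"
    by metis
  have \<psi>_\<psi>': "\<psi> (\<psi>' p) = p" for p
    using \<phi>_inv[of "to_fract p"] by (simp add: \<psi> \<psi>')
  have \<psi>_mult: "\<psi> (p * q) = \<psi> p * \<psi> q" for p q
    using aut_mult[of "to_fract p" "to_fract q"] by (simp only: \<psi> to_fract_mult[symmetric] to_fract_eq_iff)
  \<comment> \<open>Units of the polynomial ring are constants, and these are fixed.\<close>
  have \<psi>_unit: "\<psi> p dvd 1" if unit: "p dvd 1" for p
  proof -
    obtain u where "u \<noteq> 0" "p = scalar2 u"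
      using unit[unfolded is_unit_iff_scalar2] by blast
    then have "\<psi> p = p"
      using aut_const[of u] by (simp only: \<psi> to_fract_eq_iff)
    then show ?thesis
      using unit by simp
  qed
  have inj: "p = q" if "\<psi> p = \<psi> q" for p q
    using that \<psi> by (metis aut_eq_iff to_fract_eq_iff)
  obtain j where j: "j \<in> {1..n}" "det i j \<noteq> 0"
    using exists_transversal[OF i] .
  have "const (det i j) * (\<Prod>k\<in>{1..n}. to_fract (\<psi> (l k)))
      = jacobian (to_fract (\<psi> (l i))) (to_fract (\<psi> (l j))) * to_fract f"
    using transversal_jacobian[OF i j(1)] by (simp only: \<psi>)
  moreover obtain q where "jacobian (to_fract (\<psi> (l i))) (to_fract (\<psi> (l j))) = to_fract q"
    unfolding jacobian_def pdx_to_fract pdy_to_fract by (metis to_fract_mult to_fract_diff)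
  ultimately have "to_fract (scalar2 (det i j) * (\<Prod>k\<in>{1..n}. \<psi> (l k))) = to_fract (q * f)"
    by (simp only: to_fract_mult to_fract_hom.hom_prod)
  then have eq: "scalar2 (det i j) * (\<Prod>k\<in>{1..n}. \<psi> (l k)) = q * f"
    by (simp only: to_fract_eq_iff)
  have prime: "prime_elem (l i)"
    using irreducible_line[OF i] by (simp add: ufd_class.prime_elem_iff_irreducible)
  have "l i dvd f"
    unfolding f_def by (rule dvd_prodI) (use i in auto)
  then have "l i dvd scalar2 (det i j) * (\<Prod>k\<in>{1..n}. \<psi> (l k))"
    unfolding eq by (rule dvd_mult)
  moreover have "\<not> l i dvd scalar2 (det i j)"
    by (rule prime_elem_not_dvd_scalar2[OF prime j(2)])
  ultimately have "l i dvd (\<Prod>k\<in>{1..n}. \<psi> (l k))"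
    using prime by (simp add: prime_elem_dvd_mult_iff)
  then obtain k where k: "k \<in> {1..n}" "l i dvd \<psi> (l k)"
    using prime by (elim prime_elem_dvd_prodE[rotated 2]) simp_all
  then obtain r where r: "\<psi> (l k) = l i * r"
    by (elim dvdE)
  \<comment> \<open>The factorization is pulled back along the inverse, to where irreducibility is
    known.\<close>
  have "l k = \<psi>' (l i) * \<psi>' r"
    by (rule inj) (simp only: r \<psi>_mult \<psi>_\<psi>')
  then have "\<psi>' (l i) dvd 1 \<or> \<psi>' r dvd 1"
    by (rule irreducibleD[OF irreducible_line[OF k(1)]])
  then have "l i dvd 1 \<or> r dvd 1"
    using \<psi>_unit[of "\<psi>' (l i)"] \<psi>_unit[of "\<psi>' r"] by (auto simp only: \<psi>_\<psi>')
  then have "r dvd 1"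
    using prime by (simp add: prime_elem_def)
  then obtain u where u: "u \<noteq> 0" "r = scalar2 u"
    unfolding is_unit_iff_scalar2 by blast
  have "\<phi> (to_fract (l k)) = const u * to_fract (l i)"
    by (simp add: \<psi> r u(2) mult.commute)
  then show ?thesis
    using k(1) u(1) by blast
qed

text \<open>Divisibility produces preimages of lines; applied to the inverse automorphism, it
  produces images.\<close>

lemma line_image:
  assumes "i \<in> {1..n}"
  obtains u where "line_perm \<phi> i \<in> {1..n}" "u \<noteq> 0"
    "\<phi> (to_fract (l i)) = const u * to_fract (l (line_perm \<phi> i))"
proof -
  interpret inverse: line_arrangement_automorphism l n a b c f "inv_into UNIV \<phi>"
    by (rule inverse)
  have \<phi>_inv: "\<phi> (inv_into UNIV \<phi> g) = g" for g
    by (rule surj_f_inv_f[OF bij_is_surj[OF aut_bij]])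
  obtain j u where j: "j \<in> {1..n}" "u \<noteq> 0"
      "inv_into UNIV \<phi> (to_fract (l j)) = const u * to_fract (l i)"
    using inverse.line_preimage[OF assms] by blast
  have "to_fract (l j) = const u * \<phi> (to_fract (l i))"
    using \<phi>_inv[of "to_fract (l j)"] by (simp add: j(3))
  then have eq: "\<phi> (to_fract (l i)) = const (1 / u) * to_fract (l j)"
    using j(2) by (simp add: mult.assoc[symmetric] to_fract_mult[symmetric] scalar2_simps(4)[symmetric]
        scalar2_simps(6) del: to_fract_mult to_fract_hom.hom_mult)
  have "line_perm \<phi> i = j"
    using line_perm_eqI[OF assms j(1), of "1 / u" \<phi>] eq j(2) by simp
  then show ?thesis
    using that[of "1 / u"] j(1,2) eq by simp
qed

text \<open>Lines with associated images are themselves associated, as \<open>\<phi>\<close> is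
  injective and fixes constants, so they have the same index. Finiteness then gives
  surjectivity.\<close>

lemma line_perm_permutes: "line_perm \<phi> permutes {1..n}"
proof (rule bij_imp_permutes)
  have "inj_on (line_perm \<phi>) {1..n}"
  proof (rule inj_onI)
    fix i j assume ij: "i \<in> {1..n}" "j \<in> {1..n}" and eq: "line_perm \<phi> i = line_perm \<phi> j"
    obtain u where u: "u \<noteq> 0" "\<phi> (to_fract (l i)) = const u * to_fract (l (line_perm \<phi> i))"
      using line_image[OF ij(1)] .
    obtain v where v: "v \<noteq> 0" "\<phi> (to_fract (l j)) = const v * to_fract (l (line_perm \<phi> j))"
      using line_image[OF ij(2)] .
    have "\<phi> (const v * to_fract (l i)) = \<phi> (const u * to_fract (l j))"
      using u(2) v(2) eq by simp
    then have "const v * to_fract (l i) = const u * to_fract (l j)"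
      by (simp only: aut_eq_iff)
    then show "i = j"
      by (rule associated_lines_eq[OF ij v(1) u(1)])
  qed
  moreover have "line_perm \<phi> ` {1..n} \<subseteq> {1..n}"
    using line_image by blast
  ultimately show "bij_betw (line_perm \<phi>) {1..n} {1..n}"
    by (simp add: bij_betw_def endo_inj_surj)
  show "line_perm \<phi> i = i" if "i \<notin> {1..n}" for i
    using that by (rule line_perm_outside)
qed

end

text \<open>Constants are fixed by \<open>\<phi>\<close>, so the scalar factors of the two
  automorphisms just multiply.\<close>

lemma (in line_arrangement) line_perm_comp:
  assumes "poisson_automorphism (to_fract f) \<phi>" "poisson_automorphism (to_fract f) \<psi>"
  shows "line_perm (\<phi> \<circ> \<psi>) = line_perm \<phi> \<circ> line_perm \<psi>"
proof
  fix i
  interpret \<phi>: line_arrangement_automorphism l n a b c f \<phi>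
    using assms(1) line_arrangement_automorphism_iff by blast
  interpret \<psi>: line_arrangement_automorphism l n a b c f \<psi>
    using assms(2) line_arrangement_automorphism_iff by blast
  show "line_perm (\<phi> \<circ> \<psi>) i = (line_perm \<phi> \<circ> line_perm \<psi>) i"
  proof (cases "i \<in> {1..n}")
    case True
    obtain u where u: "line_perm \<psi> i \<in> {1..n}" "u \<noteq> 0"
        "\<psi> (to_fract (l i)) = const u * to_fract (l (line_perm \<psi> i))"
      using \<psi>.line_image[OF True] .
    obtain v where v: "line_perm \<phi> (line_perm \<psi> i) \<in> {1..n}" "v \<noteq> 0"
        "\<phi> (to_fract (l (line_perm \<psi> i))) = const v * to_fract (l (line_perm \<phi> (line_perm \<psi> i)))"
      using \<phi>.line_image[OF u(1)] .
    have "(\<phi> \<circ> \<psi>) (to_fract (l i)) = const (u * v) * to_fract (l (line_perm \<phi> (line_perm \<psi> i)))"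
      by (simp add: u(3) v(3) scalar2_simps mult.assoc)
    then show ?thesis
      using line_perm_eqI[OF True v(1), of "u * v"] u(2) v(2) by simp
  next
    case False
    then show ?thesis
      by (simp only: line_perm_outside comp_apply not_False_eq_True)
  qed
qed

section \<open>Automorphisms fixing every line\<close>

context line_arrangement
begin

definition homothety :: "('k poly poly fract \<Rightarrow> 'k poly poly fract) \<Rightarrow> 'k \<Rightarrow> bool" where
  "homothety \<phi> u \<longleftrightarrow> (\<forall>i\<in>{1..n}. \<phi> (to_fract (l i)) = const u * to_fract (l i))"

lemma homothetyD: "homothety \<phi> u \<Longrightarrow> i \<in> {1..n} \<Longrightarrow> \<phi> (to_fract (l i)) = const u * to_fract (l i)"
  unfolding homothety_def by (rule bspec)

lemma homothety_unique:
  assumes "homothety \<phi> u" "homothety \<phi> v"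
  shows "u = v"
proof -
  have 1: "1 \<in> {1..n}"
    using n_ge_4 by simp
  show ?thesis
    using homothetyD[OF assms(1) 1] homothetyD[OF assms(2) 1] line_nonzero[OF 1] by simp
qed

lemma homothety_line_perm:
  assumes "homothety \<phi> u" "u \<noteq> 0"
  shows "line_perm \<phi> = id"
proof
  fix i
  show "line_perm \<phi> i = id i"
  proof (cases "i \<in> {1..n}")
    case True
    have "line_perm \<phi> i = i"
      by (rule line_perm_eqI[OF True True assms(2)]) (rule homothetyD[OF assms(1) True])
    then show ?thesis
      by simp
  next
    case False
    then show ?thesis
      by (simp only: line_perm_outside id_apply not_False_eq_True)
  qed
qed

text \<open>Linear independence of two transversal lines and 1 over the base field; eliminating one
  coefficient from the linear parts leaves a multiple of the determinant.\<close>

lemma transversal_independent: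
  assumes "i \<in> {1..n}" "j \<in> {1..n}" "det i j \<noteq> 0"
    and "const \<alpha> * to_fract (l i) + const \<beta> * to_fract (l j) + const \<gamma> = 0"
  shows "\<alpha> = 0" "\<beta> = 0"
proof -
  have "to_fract (scalar2 \<alpha> * l i + scalar2 \<beta> * l j + scalar2 \<gamma>) = to_fract 0"
    using assms(4) by simp
  then have "scalar2 \<alpha> * l i + scalar2 \<beta> * l j + scalar2 \<gamma> = 0"
    by (simp only: to_fract_eq_iff)
  moreover have "scalar2 \<alpha> * l i + scalar2 \<beta> * l j + scalar2 \<gamma>
      = linform (\<alpha> * a i + \<beta> * a j) (\<alpha> * b i + \<beta> * b j) (\<alpha> * c i + \<beta> * c j + \<gamma>)"
    using assms by (simp add: l_linform linform_def scalar2_simps algebra_simps)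
  ultimately have eq: "\<alpha> * a i + \<beta> * a j = 0" "\<alpha> * b i + \<beta> * b j = 0"
    by (simp_all add: linform_pCons)
  have "\<alpha> * det i j = (\<alpha> * a i + \<beta> * a j) * b j - (\<alpha> * b i + \<beta> * b j) * a j"
    "\<beta> * det i j = (\<alpha> * b i + \<beta> * b j) * a i - (\<alpha> * a i + \<beta> * a j) * b i"
    by (simp_all add: det_def algebra_simps)
  then have "\<alpha> * det i j = 0" "\<beta> * det i j = 0"
    by (simp_all only: eq mult_zero_left diff_self)
  then show "\<alpha> = 0" "\<beta> = 0"
    using assms(3) by simp_all
qed

lemma det_swap: "det j i = - det i j"
  by (simp add: det_def mult.commute)

end

context line_arrangement_automorphism
begin

text \<open>The third line is a combination of the first two and a constant. Applying
  \<open>\<phi>\<close> and comparing coefficients, both of them nonzero, gives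
  \<open>s k = s i\<close> and \<open>s k = s j\<close>.\<close>

lemma homothety_transversal_triple:
  assumes s: "\<And>i. i \<in> {1..n} \<Longrightarrow> \<phi> (to_fract (l i)) = const (s i) * to_fract (l i)"
    and ijk: "i \<in> {1..n}" "j \<in> {1..n}" "k \<in> {1..n}"
    and det: "det i j \<noteq> 0" "det i k \<noteq> 0" "det j k \<noteq> 0"
  shows "s i = s j"
proof -
  \<comment> \<open>Cramer's rule for the linear part of \<open>l k\<close> in terms of those of
    \<open>l i\<close> and \<open>l j\<close>; \<open>\<gamma>\<close> absorbs the
    constants.\<close>
  define \<alpha> \<beta> \<gamma> where "\<alpha> = det k j" and "\<beta> = det i k" and "\<gamma> = det i j * c k - \<alpha> * c i - \<beta> * c j"
  have "scalar2 (det i j) * l k = scalar2 \<alpha> * l i + scalar2 \<beta> * l j + scalar2 \<gamma>"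
    using ijk by (simp add: l_linform linform_def \<alpha>_def \<beta>_def \<gamma>_def det_def scalar2_simps algebra_simps)
  then have rel: "const (det i j) * to_fract (l k)
      = const \<alpha> * to_fract (l i) + const \<beta> * to_fract (l j) + const \<gamma>"
    by (simp only: to_fract_mult[symmetric] to_fract_add[symmetric])
  have "\<phi> (const (det i j) * to_fract (l k))
      = \<phi> (const \<alpha> * to_fract (l i) + const \<beta> * to_fract (l j) + const \<gamma>)"
    by (simp only: rel)
  then have image: "const (s k) * (const (det i j) * to_fract (l k))
      = const \<alpha> * (const (s i) * to_fract (l i)) + const \<beta> * (const (s j) * to_fract (l j)) + const \<gamma>"
    unfolding aut_add aut_mult aut_const s[OF ijk(1)] s[OF ijk(2)] s[OF ijk(3)]
    by (simp only: mult.left_commute)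
  have "const (\<alpha> * (s k - s i)) * to_fract (l i) + const (\<beta> * (s k - s j)) * to_fract (l j)
      + const (\<gamma> * (s k - 1)) = 0"
    using image unfolding rel by (simp add: scalar2_simps algebra_simps)
  then have "\<alpha> * (s k - s i) = 0" "\<beta> * (s k - s j) = 0"
    using transversal_independent[OF ijk(1,2) det(1)] by blast+
  then show ?thesis
    using det det_swap[of k j] by (simp add: \<alpha>_def \<beta>_def)
qed

text \<open>Parallel lines are linked by a nonzero constant \<open>v\<close>, which
  \<open>\<phi>\<close> cannot scale; comparison of constant terms leaves
  \<open>s j = 1\<close>.\<close>

lemma homothety_parallel:
  assumes s: "\<And>i. i \<in> {1..n} \<Longrightarrow> \<phi> (to_fract (l i)) = const (s i) * to_fract (l i)"
    and ij: "i \<in> {1..n}" "j \<in> {1..n}" "i \<noteq> j" "det i j = 0"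
  shows "s j = 1"
proof -
  obtain u v where v: "v \<noteq> 0" and lj: "l j = scalar2 u * l i + scalar2 v"
    using parallel_lines[OF ij] .
  then have rel: "to_fract (l j) = const u * to_fract (l i) + const v"
    by simp
  have "\<phi> (to_fract (l j)) = \<phi> (const u * to_fract (l i) + const v)"
    by (simp only: rel)
  then have "const (s j) * to_fract (l j) = const u * (const (s i) * to_fract (l i)) + const v"
    unfolding aut_add aut_mult aut_const s[OF ij(1)] s[OF ij(2)] .
  then have "const (s j) * (const u * to_fract (l i) + const v)
      = const u * (const (s i) * to_fract (l i)) + const v"
    unfolding rel .
  then have eq: "const (u * (s j - s i)) * to_fract (l i) + const (v * (s j - 1)) = 0"
    by (simp add: scalar2_simps algebra_simps)
  obtain k where k: "k \<in> {1..n}" "det i k \<noteq> 0"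
    using exists_transversal[OF ij(1)] .
  \<comment> \<open>An auxiliary transversal line enters with coefficient 0, so that linear
    independence applies.\<close>
  have "const (u * (s j - s i)) * to_fract (l i) + const 0 * to_fract (l k) + const (v * (s j - 1)) = 0"
    using eq by (simp only: scalar2_simps(5) to_fract_0 mult_zero_left add_0_right)
  then have "u * (s j - s i) = 0"
    by (rule transversal_independent(1)[OF ij(1) k])
  then have "const (v * (s j - 1)) = 0"
    using eq by (simp only: scalar2_simps(5) to_fract_0 mult_zero_left add_0)
  then show ?thesis
    using v by simp
qed

text \<open>Without a line transversal to both, the arrangement consists of two parallel classes.
  The lines transversal to \<open>i\<close> are then parallel to \<open>j\<close>, and as there are
  at least three, one of them differs from \<open>j\<close>; so \<open>s j = 1\<close>, and likewise
  \<open>s i = 1\<close>.\<close>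

lemma homothety_transversal:
  assumes s: "\<And>i. i \<in> {1..n} \<Longrightarrow> \<phi> (to_fract (l i)) = const (s i) * to_fract (l i)"
    and ij: "i \<in> {1..n}" "j \<in> {1..n}" "det i j \<noteq> 0"
  shows "s i = s j"
proof (cases "\<exists>k\<in>{1..n}. det i k \<noteq> 0 \<and> det j k \<noteq> 0")
  case True
  then show ?thesis
    using homothety_transversal_triple[OF s ij(1,2) _ ij(3)] by blast
next
  case False
  have *: "s j = 1"
    if ij: "i \<in> {1..n}" "j \<in> {1..n}" and no: "\<And>k. k \<in> {1..n} \<Longrightarrow> det i k \<noteq> 0 \<Longrightarrow> det j k = 0" for i j
  proof -
    have "\<not> {k \<in> {1..n}. a i * b k - a k * b i \<noteq> 0} \<subseteq> {j}"
    proof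
      assume "{k \<in> {1..n}. a i * b k - a k * b i \<noteq> 0} \<subseteq> {j}"
      from card_mono[OF _ this] show False
        using three_transversal[OF ij(1)] by simp
    qed
    then obtain k where "k \<in> {1..n}" "det i k \<noteq> 0" "k \<noteq> j"
      by (auto simp: det_def)
    then have "det k j = 0" "k \<in> {1..n}" "k \<noteq> j"
      using no det_swap[of k j] by auto
    then show ?thesis
      using homothety_parallel[OF s _ ij(2)] by blast
  qed
  have "s j = 1" "s i = 1"
    using *[OF ij(1,2)] *[OF ij(2,1)] False by blast+
  then show ?thesis
    by simp
qed

text \<open>Parallel and transversal pairs of lines have equal factors. The exponent
  \<open>n\<close> stems from the product of all images, the exponent 2 from the bilinear Jacobian
  of two of them.\<close>

lemma line_perm_id_imp_homothety:
  assumes id: "line_perm \<phi> = id"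
  obtains u where "u \<noteq> 0" "homothety \<phi> u" "u ^ (n - 2) = 1"
proof -
  have "\<exists>u. u \<noteq> 0 \<and> \<phi> (to_fract (l i)) = const u * to_fract (l i)" if "i \<in> {1..n}" for i
    using line_image[OF that] by (metis id id_apply)
  then obtain s where s: "\<And>i. i \<in> {1..n} \<Longrightarrow> s i \<noteq> 0"
      "\<And>i. i \<in> {1..n} \<Longrightarrow> \<phi> (to_fract (l i)) = const (s i) * to_fract (l i)"
    by metis
  have eq: "s i = s j" if ij: "i \<in> {1..n}" "j \<in> {1..n}" for i j
  proof -
    consider "i = j" | "i \<noteq> j" "det i j = 0" | "det i j \<noteq> 0"
      by blast
    then show ?thesis
    proof cases
      case 2
      have "s j = 1"
        by (rule homothety_parallel[OF s(2) ij 2])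
      moreover have "s i = 1"
        by (rule homothety_parallel[OF s(2) ij(2,1) 2(1)[symmetric]]) (simp_all add: det_swap[of j i] 2)
      ultimately show ?thesis
        by simp
    next
      case 3
      then show ?thesis
        using homothety_transversal[OF s(2) ij] by blast
    qed simp
  qed
  define u where "u = s 1"
  have 1: "1 \<in> {1..n}"
    using n_ge_4 by simp
  have "u \<noteq> 0"
    using s(1)[OF 1] by (simp add: u_def)
  have u: "\<phi> (to_fract (l i)) = const u * to_fract (l i)" if "i \<in> {1..n}" for i
    unfolding u_def using s(2)[OF that] eq[OF that 1] by simp
  have prod_l: "(\<Prod>k\<in>{1..n}. to_fract (l k)) = to_fract f"
    by (simp add: f_def to_fract_hom.hom_prod)
  obtain j where j: "j \<in> {1..n}" "det 1 j \<noteq> 0"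
    using exists_transversal[OF 1] .
  have scaled: "const u * to_fract (l i) = to_fract (linform (u * a i) (u * b i) (u * c i))"
    if "i \<in> {1..n}" for i
    unfolding l_linform[OF that] to_fract_mult[symmetric]
    by (simp add: linform_def scalar2_simps algebra_simps)
  have "(\<Prod>k\<in>{1..n}. \<phi> (to_fract (l k))) = (\<Prod>k\<in>{1..n}. const u * to_fract (l k))"
    by (rule prod.cong[OF refl]) (rule u)
  also have "\<dots> = const u ^ n * to_fract f"
    by (simp only: prod.distrib prod_l prod_constant card_atLeastAtMost diff_Suc_1)
  finally have "const (det 1 j) * (const u ^ n * to_fract f)
      = jacobian (\<phi> (to_fract (l 1))) (\<phi> (to_fract (l j))) * to_fract f"
    using transversal_jacobian[OF 1 j(1)] by simp
  moreover have "jacobian (\<phi> (to_fract (l 1))) (\<phi> (to_fract (l j)))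
      = const ((u * a 1) * (u * b j) - (u * a j) * (u * b 1))"
    unfolding u[OF 1] u[OF j(1)] scaled[OF 1] scaled[OF j(1)] by (rule jacobian_linform)
  moreover have "(u * a 1) * (u * b j) - (u * a j) * (u * b 1) = det 1 j * u\<^sup>2"
    by (simp add: det_def power2_eq_square algebra_simps)
  ultimately have "const (det 1 j) * (const u ^ n * to_fract f) = const (det 1 j * u\<^sup>2) * to_fract f"
    by (simp only:)
  also have "\<dots> = const (det 1 j) * (const u ^ 2 * to_fract f)"
    by (simp add: scalar2_simps power2_eq_square)
  finally have "const u ^ n = const u ^ 2"
    using f_nonzero j(2) by simp
  moreover have "const u ^ n = const u ^ 2 * const u ^ (n - 2)"
  proof -
    have "n = 2 + (n - 2)"
      using n_ge_4 by simp
    then show ?thesis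
      by (metis power_add)
  qed
  ultimately have "const u ^ (n - 2) = 1"
    using \<open>u \<noteq> 0\<close> by simp
  moreover have "const u ^ k = const (u ^ k)" for k
    by (induction k) (simp_all add: scalar2_simps)
  ultimately have "const (u ^ (n - 2)) = const 1"
    by (simp add: scalar2_simps)
  then have "u ^ (n - 2) = 1"
    by (simp only: to_fract_eq_iff scalar2_eq_iff)
  then show ?thesis
    using that[OF \<open>u \<noteq> 0\<close>] u by (simp add: homothety_def)
qed

end

section \<open>Automorphisms are determined by their scaling factor\<close>

lemma (in poisson_aut) aut_eqI:
  assumes \<psi>: "poisson_automorphism (to_fract f) \<psi>"
    and eq: "\<phi> (to_fract var_x) = \<psi> (to_fract var_x)" "\<phi> (to_fract var_y) = \<psi> (to_fract var_y)"
  shows "\<phi> = \<psi>"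
proof
  interpret \<psi>: poisson_aut f \<psi>
    by (rule poisson_aut.intro[OF \<psi>])
  have poly: "\<phi> (to_fract p) = \<psi> (to_fract p)" for p
    by (induction p rule: poly_poly_induct) (simp_all add: eq)
  fix g :: "'k poly poly fract"
  obtain p q where pq: "g = Fract p q" "q \<noteq> 0"
    by (cases g)
  have g: "g * to_fract q = to_fract p"
    using pq by (simp add: Fract_conv_to_fract)
  have "\<phi> g * \<phi> (to_fract q) = \<phi> (to_fract p)"
    by (simp only: aut_mult[symmetric] g)
  also have "\<dots> = \<psi> (to_fract p)"
    by (rule poly)
  also have "\<dots> = \<psi> g * \<psi> (to_fract q)"
    by (simp only: \<psi>.aut_mult[symmetric] g)
  finally have "\<phi> g * \<phi> (to_fract q) = \<psi> g * \<psi> (to_fract q)" .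
  then show "\<phi> g = \<psi> g"
    using pq(2) by (simp add: poly)
qed

context line_arrangement
begin

text \<open>Two transversal lines and the constants span x and y, so the scaling factor fixes both
  images. This embeds the kernel into the roots of unity.\<close>

lemma homothety_eqI:
  assumes "poisson_automorphism (to_fract f) \<phi>" "poisson_automorphism (to_fract f) \<psi>"
    and hom: "homothety \<phi> u" "homothety \<psi> u"
  shows "\<phi> = \<psi>"
proof -
  interpret \<phi>: poisson_aut f \<phi>
    by (rule poisson_aut.intro[OF assms(1)])
  interpret \<psi>: poisson_aut f \<psi>
    by (rule poisson_aut.intro[OF assms(2)])
  have 1: "1 \<in> {1..n}"
    using n_ge_4 by simp
  obtain j where j: "j \<in> {1..n}" "det 1 j \<noteq> 0"
    using exists_transversal[OF 1] .
  have l: "\<phi> (to_fract (l i)) = \<psi> (to_fract (l i))" if "i \<in> {1..n}" for i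
    using homothetyD[OF hom(1) that] homothetyD[OF hom(2) that] by simp
  have "const (det 1 j) * \<phi> (to_fract var_x) = const (det 1 j) * \<psi> (to_fract var_x)"
    using arg_cong[OF var_x_conv_lines[OF 1 j(1)], of "\<lambda>p. \<phi> (to_fract p)"]
      arg_cong[OF var_x_conv_lines[OF 1 j(1)], of "\<lambda>p. \<psi> (to_fract p)"] l[OF 1] l[OF j(1)]
    by simp
  moreover have "const (det 1 j) * \<phi> (to_fract var_y) = const (det 1 j) * \<psi> (to_fract var_y)"
    using arg_cong[OF var_y_conv_lines[OF 1 j(1)], of "\<lambda>p. \<phi> (to_fract p)"]
      arg_cong[OF var_y_conv_lines[OF 1 j(1)], of "\<lambda>p. \<psi> (to_fract p)"] l[OF 1] l[OF j(1)]
    by simp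
  ultimately show ?thesis
    using j(2) by (intro \<phi>.aut_eqI[OF assms(2)]) simp_all
qed

end

section \<open>Primitive roots of unity\<close>

text \<open>A root of 1 + x + ... + x^(m-1) will do: it is not 1, because \<open>m\<close> is
  nonzero in characteristic zero.\<close>

lemma exists_nontrivial_root_of_unity:
  assumes "m > (1::nat)"
  shows "\<exists>\<eta>::'k::{alg_closed_field, field_char_0}. \<eta> ^ m = 1 \<and> \<eta> \<noteq> 1"
proof -
  define k where "k = m - 2"
  have k: "m = Suc (Suc k)"
    using assms by (simp add: k_def)
  have "\<exists>x::'k. (\<Sum>i\<le>Suc k. 1 * x ^ i) = 0"
    by (rule alg_closed) auto
  then obtain x :: 'k where x: "(\<Sum>i<m. x ^ i) = 0"
    by (auto simp: k lessThan_Suc_atMost)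
  have "x ^ m - 1 = (x - 1) * (\<Sum>i<m. x ^ i)"
    by (rule power_diff_1_eq)
  then have "x ^ m = 1"
    using x by simp
  moreover have "x \<noteq> 1"
    using x assms by auto
  ultimately show ?thesis
    by blast
qed

text \<open>Induction by splitting off a prime \<open>q\<close>: a q-th root of a primitive root of
  order \<open>m'\<close> has order \<open>m'\<close> or \<open>q * m'\<close>, and the smaller
  order is avoided by a correction with a nontrivial q-th root of unity.\<close>

lemma exists_primitive_root_of_unity:
  fixes m :: nat
  assumes "m > 0"
  shows "\<exists>\<zeta>::'k::{alg_closed_field, field_char_0}. \<forall>k. \<zeta> ^ k = 1 \<longleftrightarrow> m dvd k"
  using assms
proof (induction m rule: less_induct)
  case (less m)
  show ?case
  proof (cases "m = 1")
    case True
    then show ?thesis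
      by (intro exI[of _ 1]) simp
  next
    case False
    then obtain q where q: "Factorial_Ring.prime q" "q dvd m"
      using prime_factor_nat by blast
    from q(2) obtain m' where m: "m = q * m'"
      by (elim dvdE)
    have "m' > 0" "m' < m" "q > 1"
      using m less.prems prime_gt_1_nat[OF q(1)] by auto
    then obtain \<xi> :: 'k where \<xi>: "\<And>k. \<xi> ^ k = 1 \<longleftrightarrow> m' dvd k"
      using less.IH[of m'] by blast
    obtain \<rho> where \<rho>: "\<rho> ^ q = \<xi>"
      using nth_root_exists[of q \<xi>] \<open>q > 1\<close> by auto
    have "\<exists>\<zeta>. \<zeta> ^ q = \<xi> \<and> \<zeta> ^ m' \<noteq> 1"
    proof (cases "\<rho> ^ m' = 1")
      case True
      obtain \<eta> :: 'k where \<eta>: "\<eta> ^ q = 1" "\<eta> \<noteq> 1"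
        using exists_nontrivial_root_of_unity \<open>q > 1\<close> by blast
      \<comment> \<open>Otherwise \<open>\<xi>\<close> would already become 1 at the exponent
        \<open>m'\<close> divided by \<open>q\<close>, a proper divisor of its order.\<close>
      have "\<not> q dvd m'"
      proof
        assume "q dvd m'"
        then obtain r where r: "m' = q * r" ..
        then have "\<xi> ^ r = 1"
          using True \<rho> by (simp add: power_mult)
        then have "m' dvd r"
          by (simp only: \<xi>)
        then show False
          using r \<open>m' > 0\<close> \<open>q > 1\<close> by (auto dest: dvd_imp_le)
      qed
      then have "Rings.coprime m' q"
        using q(1) by (metis prime_imp_coprime Rings.coprime_commute)
      have "\<eta> ^ m' \<noteq> 1"
      proof
        assume *: "\<eta> ^ m' = 1"
        obtain x y where "m' * x = q * y + 1"
          using coprime_bezout_strong[OF \<open>Rings.coprime m' q\<close>] \<open>q > 1\<close> by auto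
        then have "\<eta> ^ (m' * x) = \<eta> ^ (q * y) * \<eta>"
          by (simp add: power_add)
        then show False
          using * \<eta> by (simp add: power_mult)
      qed
      then show ?thesis
        using \<rho> True \<eta>(1) by (intro exI[of _ "\<rho> * \<eta>"]) (simp add: power_mult_distrib)
    next
      case False
      then show ?thesis
        using \<rho> by blast
    qed
    then obtain \<zeta> where \<zeta>: "\<zeta> ^ q = \<xi>" "\<zeta> ^ m' \<noteq> 1"
      by blast
    have \<zeta>_m: "\<zeta> ^ m = 1"
      using \<xi>[of m'] by (simp add: m power_mult \<zeta>(1))
    have "m dvd k" if k: "\<zeta> ^ k = 1" for k
    proof -
      have "\<xi> ^ k = 1"
        using k by (simp add: \<zeta>(1)[symmetric] power_mult[symmetric] mult.commute) (simp add: power_mult)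
      then obtain j where j: "k = m' * j"
        by (auto simp: \<xi>)
      \<comment> \<open>If \<open>q\<close> did not divide \<open>j\<close>, a Bezout relation would
        turn \<open>\<zeta> ^ k = 1\<close> into \<open>\<zeta> ^ m' = 1\<close>.\<close>
      have "q dvd j"
      proof (rule ccontr)
        assume "\<not> q dvd j"
        then have "Rings.coprime j q"
          using q(1) by (metis prime_imp_coprime Rings.coprime_commute)
        then obtain x y where "j * x = q * y + 1"
          using coprime_bezout_strong[of j q] \<open>q > 1\<close> by auto
        then have "m' * (j * x) = m' * (q * y + 1)"
          by simp
        then have "k * x = m * y + m'"
          by (simp add: j m mult_ac distrib_left)
        then have "\<zeta> ^ (k * x) = \<zeta> ^ (m * y) * \<zeta> ^ m'"
          by (simp add: power_add)
        then show False
          using k \<zeta>_m \<zeta>(2) by (simp add: power_mult)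
      qed
      then show ?thesis
        by (auto simp: m j)
    qed
    moreover have "\<zeta> ^ k = 1" if "m dvd k" for k
      using that \<zeta>_m by (auto simp: power_mult)
    ultimately show ?thesis
      by blast
  qed
qed

text \<open>The first \<open>m\<close> powers of \<open>\<zeta>\<close> are distinct roots of x^m -
  1, which has at most \<open>m\<close> roots.\<close>

lemma root_of_unity_conv_primitive:
  fixes \<zeta> u :: "'k::field" and m :: nat
  assumes \<zeta>: "\<And>k. \<zeta> ^ k = 1 \<longleftrightarrow> m dvd k" and "m > 0" and u: "u ^ m = 1"
  obtains k where "k < m" "u = \<zeta> ^ k"
proof -
  define p :: "'k poly" where "p = monom 1 m - 1"
  have "\<zeta> \<noteq> 0"
    using \<zeta>[of m] \<open>m > 0\<close> by (auto simp: power_0_left)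
  have deg: "degree p \<le> m"
    unfolding p_def by (intro degree_diff_le) (auto simp: degree_monom_eq)
  have "poly p 0 \<noteq> 0"
    using \<open>m > 0\<close> by (simp add: p_def poly_monom power_0_left)
  then have "p \<noteq> 0"
    by auto
  have "inj_on ((^) \<zeta>) {..<m}"
  proof (rule linorder_inj_onI)
    fix i j assume ij: "i < j" "i \<in> {..<m}" "j \<in> {..<m}"
    have "\<zeta> ^ j = \<zeta> ^ i * \<zeta> ^ (j - i)"
      using ij by (simp add: power_add[symmetric])
    moreover have "\<zeta> ^ (j - i) \<noteq> 1"
      using ij \<zeta>[of "j - i"] by (auto dest: dvd_imp_le)
    ultimately show "\<zeta> ^ i \<noteq> \<zeta> ^ j"
      using \<open>\<zeta> \<noteq> 0\<close> by simp
  qed auto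
  then have card: "card ((^) \<zeta> ` {..<m}) = m"
    by (simp add: card_image)
  have sub: "(^) \<zeta> ` {..<m} \<subseteq> {x. poly p x = 0}"
  proof
    fix x assume "x \<in> (^) \<zeta> ` {..<m}"
    then obtain k where "x = \<zeta> ^ k"
      by auto
    then have "x ^ m = 1"
      using \<zeta>[of "k * m"] by (simp add: power_mult)
    then show "x \<in> {x. poly p x = 0}"
      by (simp add: p_def poly_monom)
  qed
  have "(^) \<zeta> ` {..<m} = {x. poly p x = 0}"
    using card_subset_eq[OF poly_roots_finite[OF \<open>p \<noteq> 0\<close>] sub] card_mono[OF poly_roots_finite[OF \<open>p \<noteq> 0\<close>] sub]
      card_poly_roots_bound[OF \<open>p \<noteq> 0\<close>] deg card by simp
  moreover have "u \<in> {x. poly p x = 0}"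
    using u by (simp add: p_def poly_monom)
  ultimately show ?thesis
    using that by auto
qed

section \<open>Scalings of a homogeneous arrangement\<close>

text \<open>The extension of a ring endomorphism to the fraction field. It is well defined for
  injective \<open>S\<close>, which the context below assumes in the form
  \<open>eq_0\<close>.\<close>

definition fract_map :: "('a::idom \<Rightarrow> 'a) \<Rightarrow> 'a fract \<Rightarrow> 'a fract" where
  "fract_map S g = (THE w. \<exists>p q. q \<noteq> 0 \<and> g = Fract p q \<and> w = Fract (S p) (S q))"

context
  fixes S :: "'a::idom \<Rightarrow> 'a"
  assumes add: "\<And>p q. S (p + q) = S p + S q" and mult: "\<And>p q. S (p * q) = S p * S q"
    and one: "S 1 = 1" and eq_0: "\<And>p. S p = 0 \<longleftrightarrow> p = 0"
begin

lemma fract_map_Fract: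
  assumes "q \<noteq> 0"
  shows "fract_map S (Fract p q) = Fract (S p) (S q)"
  unfolding fract_map_def
proof (rule the_equality)
  show "\<exists>p' q'. q' \<noteq> 0 \<and> Fract p q = Fract p' q' \<and> Fract (S p) (S q) = Fract (S p') (S q')"
    using assms by blast
next
  fix w assume "\<exists>p' q'. q' \<noteq> 0 \<and> Fract p q = Fract p' q' \<and> w = Fract (S p') (S q')"
  then obtain p' q' where *: "q' \<noteq> 0" "Fract p q = Fract p' q'" "w = Fract (S p') (S q')"
    by (elim exE conjE)
  have "p * q' = p' * q"
    using *(1,2) assms by (simp add: eq_fract)
  then have "S p * S q' = S p' * S q"
    by (simp only: mult[symmetric])
  moreover have "S q \<noteq> 0" "S q' \<noteq> 0"
    using eq_0 assms *(1) by blast+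
  ultimately show "w = Fract (S p) (S q)"
    by (simp add: *(3) eq_fract)
qed

lemma fract_map_to_fract: "fract_map S (to_fract p) = to_fract (S p)"
  by (simp add: to_fract_def fract_map_Fract one)

lemma fract_map_mult: "fract_map S (g * h) = fract_map S g * fract_map S h"
  by (cases g; cases h) (simp add: fract_map_Fract mult)

lemma fract_map_add: "fract_map S (g + h) = fract_map S g + fract_map S h"
proof -
  obtain a b where g: "g = Fract a b" "b \<noteq> 0"
    by (cases g)
  obtain c d where h: "h = Fract c d" "d \<noteq> 0"
    by (cases h)
  have "S b \<noteq> 0" "S d \<noteq> 0"
    using eq_0 g(2) h(2) by blast+
  then show ?thesis
    using g(2) h(2) by (simp add: g(1) h(1) fract_map_Fract add mult)
qed

end

text \<open>The definition as a substitution gives multiplicativity; almost everything else is read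
  off from \<open>coeff_scale2\<close>, by which monomials of total degree d are multiplied by the
  d-th power of \<open>t\<close>.\<close>

definition scale2 :: "'k::field \<Rightarrow> 'k poly poly \<Rightarrow> 'k poly poly" where
  "scale2 t p = pcompose (map_poly (\<lambda>q. pcompose q [:0, t:]) p) [:0, [:t:]:]"

lemma coeff_scale2: "coeff (coeff (scale2 t p) j) i = t ^ (i + j) * coeff (coeff p j) i"
proof -
  have "[:t:] ^ j = [:t ^ j:]"
    by (induction j) simp_all
  then show ?thesis
    by (simp add: scale2_def coeff_pcompose_linear coeff_map_poly power_add mult_ac)
qed

lemma poly_poly_eqI: "(\<And>i j. coeff (coeff p j) i = coeff (coeff q j) i) \<Longrightarrow> p = q"
  by (simp add: poly_eq_iff)

lemma scale2_add: "scale2 t (p + q) = scale2 t p + scale2 t q"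
  by (rule poly_poly_eqI) (simp add: coeff_scale2 distrib_left)

lemma scale2_mult: "scale2 t (p * q) = scale2 t p * scale2 t q"
proof -
  interpret comm_ring_hom "\<lambda>q::'a poly. pcompose q [:0, t:]"
    by unfold_locales (simp_all add: pcompose_add pcompose_mult)
  interpret map_poly_comm_ring_hom "\<lambda>q::'a poly. pcompose q [:0, t:]" ..
  show ?thesis
    by (simp add: scale2_def hom_mult pcompose_mult)
qed

lemma scale2_scalar2: "scale2 t (scalar2 u) = scalar2 u"
  by (rule poly_poly_eqI) (simp add: coeff_scale2 scalar2_def coeff_pCons split: nat.split)

lemma scale2_1: "scale2 t 1 = 1"
  using scale2_scalar2[of t 1] by (simp add: scalar2_simps)

lemma scale2_linform: "scale2 t (linform a b 0) = scalar2 t * linform a b 0"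
  by (rule poly_poly_eqI)
    (simp add: coeff_scale2 scalar2_def linform_pCons coeff_pCons split: nat.split)

lemma scale2_scale2: "scale2 s (scale2 t p) = scale2 (s * t) p"
  by (rule poly_poly_eqI) (simp add: coeff_scale2 power_mult_distrib)

lemma scale2_by_1: "scale2 1 p = p"
  by (rule poly_poly_eqI) (simp add: coeff_scale2)

lemma scale2_eq_0_iff: "t \<noteq> 0 \<Longrightarrow> scale2 t p = 0 \<longleftrightarrow> p = 0"
  by (simp add: poly_eq_iff coeff_scale2)

lemma scale2_prod: "scale2 t (\<Prod>i\<in>A. g i) = (\<Prod>i\<in>A. scale2 t (g i))"
  by (induction A rule: infinite_finite_induct) (simp_all add: scale2_1 scale2_mult)

lemma pdx_poly_scale2: "pdx_poly (scale2 t p) = scalar2 t * scale2 t (pdx_poly p)"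
  by (rule poly_poly_eqI) (simp add: coeff_scale2 coeff_pdx_poly coeff_pderiv scalar2_def)

lemma coeff_of_nat_mult: "coeff (of_nat k * p) i = of_nat k * coeff p i"
  by (simp add: of_nat_poly)

lemma pdy_poly_scale2: "pdy_poly (scale2 t p) = scalar2 t * scale2 t (pdy_poly p)"
  by (rule poly_poly_eqI)
    (simp add: coeff_scale2 pdy_poly_def coeff_pderiv scalar2_def coeff_of_nat_mult del: of_nat_Suc)

context
  fixes t :: "'k::field"
  assumes t: "t \<noteq> 0"
begin

lemmas fract_scale2_simps =
  fract_map_Fract[of "scale2 t", OF scale2_add scale2_mult scale2_1 scale2_eq_0_iff[OF t]]
  fract_map_to_fract[of "scale2 t", OF scale2_add scale2_mult scale2_1 scale2_eq_0_iff[OF t]]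
  fract_map_add[of "scale2 t", OF scale2_add scale2_mult scale2_1 scale2_eq_0_iff[OF t]]
  fract_map_mult[of "scale2 t", OF scale2_add scale2_mult scale2_1 scale2_eq_0_iff[OF t]]

end

lemma fract_scale2_inverse:
  fixes t :: "'k::field"
  assumes t: "t \<noteq> 0"
  shows "fract_map (scale2 (1 / t)) (fract_map (scale2 t) g) = g"
proof -
  obtain p q where g: "g = Fract p q" "q \<noteq> 0"
    by (cases g)
  have "scale2 t q \<noteq> 0"
    using g(2) scale2_eq_0_iff[OF t] by blast
  moreover have "1 / t \<noteq> 0"
    using t by simp
  ultimately show ?thesis
    using g t by (simp add: fract_scale2_simps(1) scale2_scale2 scale2_by_1)
qed

text \<open>By the chain rule, each of the two partial derivatives in a term contributes one factor
  \<open>t\<close>.\<close>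

lemma jacobian_fract_scale2:
  fixes t :: "'k::field"
  assumes t: "t \<noteq> 0"
  shows "jacobian (fract_map (scale2 t) g) (fract_map (scale2 t) h)
    = const (t\<^sup>2) * fract_map (scale2 t) (jacobian g h)"
proof -
  note simps = fract_scale2_simps[OF t]
  have pd: "pdx (fract_map (scale2 t) g) = const t * fract_map (scale2 t) (pdx g)"
    "pdy (fract_map (scale2 t) g) = const t * fract_map (scale2 t) (pdy g)" for g
  proof -
    obtain p q where g: "g = Fract p q" "q \<noteq> 0"
      by (cases g)
    have q: "scale2 t q \<noteq> 0" "q * q \<noteq> 0"
      using g(2) scale2_eq_0_iff[OF t] by auto
    have diff: "scale2 t (p - q) = scale2 t p - scale2 t q" for p q :: "'k poly poly"
      using scale2_add[of t "p - q" q] by simp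
    show "pdx (fract_map (scale2 t) g) = const t * fract_map (scale2 t) (pdx g)"
      unfolding g(1) simps(1)[OF g(2)] pdx_Fract[OF q(1)] pdx_Fract[OF g(2)] simps(1)[OF q(2)]
      by (simp add: pdx_poly_scale2 diff scale2_mult to_fract_def algebra_simps)
    show "pdy (fract_map (scale2 t) g) = const t * fract_map (scale2 t) (pdy g)"
      unfolding g(1) simps(1)[OF g(2)] pdy_Fract[OF q(1)] pdy_Fract[OF g(2)] simps(1)[OF q(2)]
      by (simp add: pdy_poly_scale2 diff scale2_mult to_fract_def algebra_simps)
  qed
  have diff: "fract_map (scale2 t) (g - h) = fract_map (scale2 t) g - fract_map (scale2 t) h" for g h
    using simps(3)[of "g - h" h] by simp
  show ?thesis
    by (simp add: jacobian_def pd diff simps(4) scalar2_simps power2_eq_square algebra_simps)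
qed

section \<open>Euler's identity and lines through the origin\<close>

definition euler_derivation :: "'k::field poly poly \<Rightarrow> 'k poly poly" where
  "euler_derivation p = var_x * pdx_poly p + var_y * pdy_poly p"

lemma derivation_euler: "derivation (euler_derivation :: 'k::field poly poly \<Rightarrow> _)"
  unfolding derivation_def euler_derivation_def
  by (simp add: derivation_add[OF derivation_pdx_poly] derivation_add[OF derivation_pdy_poly]
      pdx_poly_mult pdy_poly_mult algebra_simps)

lemma coeff_euler_derivation:
  "coeff (coeff (euler_derivation p) j) i = of_nat (i + j) * coeff (coeff p j) i"
proof -
  have "coeff (coeff (var_x * pdx_poly p) j) i = of_nat i * coeff (coeff p j) i"
    by (cases i) (simp_all add: var_x_def coeff_pdx_poly coeff_pderiv)
  moreover have "coeff (coeff (var_y * pdy_poly p) j) i = of_nat j * coeff (coeff p j) i"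
    by (cases j) (simp_all add: var_y_def pdy_poly_def coeff_pderiv coeff_of_nat_mult del: of_nat_Suc)
  ultimately show ?thesis
    by (simp add: euler_derivation_def distrib_right)
qed

lemma euler_homogeneous2:
  assumes "homogeneous2 p"
  obtains d where "euler_derivation p = scalar2 (of_nat d) * p"
proof -
  obtain d where d: "\<And>i j. coeff (coeff p j) i \<noteq> 0 \<Longrightarrow> i + j = d"
    using assms by (auto simp: homogeneous2_def support2_def)
  have "euler_derivation p = scalar2 (of_nat d) * p"
  proof (rule poly_poly_eqI)
    fix i j
    show "coeff (coeff (euler_derivation p) j) i = coeff (coeff (scalar2 (of_nat d) * p) j) i"
      using d[of j i] by (cases "coeff (coeff p j) i = 0") (auto simp: coeff_euler_derivation scalar2_def)
  qed
  then show ?thesis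
    using that by blast
qed

text \<open>The constant term measures the failure of Euler's identity, and thus whether the line
  misses the origin.\<close>

lemma euler_linform: "euler_derivation (linform a b c) = linform a b c - scalar2 c"
  by (simp add: euler_derivation_def pdx_poly_linform pdy_poly_linform)
    (simp add: linform_def mult.commute)

context line_arrangement
begin

text \<open>By the Leibniz rule the Euler derivative of \<open>f\<close> is \<open>n * f\<close>
  minus the sum of all \<open>c k\<close> times the product of the other lines, and by homogeneity
  it is a multiple of \<open>f\<close>. Modulo \<open>l i\<close> only the summand of
  \<open>c i\<close> survives, so \<open>c i \<noteq> 0\<close> would make \<open>l i\<close> divide
  another line.\<close>

lemma homogeneous_imp_through_origin:
  assumes "homogeneous2 f" and i: "i \<in> {1..n}"
  shows "c i = 0"
proof (rule ccontr)
  assume "c i \<noteq> 0"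
  obtain d where d: "euler_derivation f = scalar2 (of_nat d) * f"
    using euler_homogeneous2[OF assms(1)] .
  have "euler_derivation f = (\<Sum>k\<in>{1..n}. euler_derivation (l k) * (\<Prod>j\<in>{1..n} - {k}. l j))"
    unfolding f_def by (rule derivation_prod[OF derivation_euler]) simp
  also have "\<dots> = (\<Sum>k\<in>{1..n}. f - scalar2 (c k) * (\<Prod>j\<in>{1..n} - {k}. l j))"
  proof (rule sum.cong[OF refl])
    fix k assume k: "k \<in> {1..n}"
    have "f = l k * (\<Prod>j\<in>{1..n} - {k}. l j)"
      unfolding f_def using k by (intro prod.remove) auto
    moreover have "euler_derivation (l k) = l k - scalar2 (c k)"
      using euler_linform[of "a k" "b k" "c k"] by (simp only: l_linform[OF k])
    ultimately show "euler_derivation (l k) * (\<Prod>j\<in>{1..n} - {k}. l j)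
        = f - scalar2 (c k) * (\<Prod>j\<in>{1..n} - {k}. l j)"
      by (simp add: left_diff_distrib)
  qed
  also have "\<dots> = of_nat n * f - (\<Sum>k\<in>{1..n}. scalar2 (c k) * (\<Prod>j\<in>{1..n} - {k}. l j))"
    by (simp add: sum_subtractf)
  also have "(\<Sum>k\<in>{1..n}. scalar2 (c k) * (\<Prod>j\<in>{1..n} - {k}. l j))
      = scalar2 (c i) * (\<Prod>j\<in>{1..n} - {i}. l j)
        + (\<Sum>k\<in>{1..n} - {i}. scalar2 (c k) * (\<Prod>j\<in>{1..n} - {k}. l j))"
    using i by (intro sum.remove) auto
  finally have eq: "scalar2 (c i) * (\<Prod>j\<in>{1..n} - {i}. l j)
      = (of_nat n - scalar2 (of_nat d)) * f
        - (\<Sum>k\<in>{1..n} - {i}. scalar2 (c k) * (\<Prod>j\<in>{1..n} - {k}. l j))"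
    unfolding d by (simp add: algebra_simps)
  have "l i dvd f"
    unfolding f_def by (rule dvd_prodI) (use i in auto)
  moreover have "l i dvd (\<Prod>j\<in>{1..n} - {k}. l j)" if "k \<in> {1..n} - {i}" for k
    by (rule dvd_prodI) (use i that in auto)
  ultimately have "l i dvd scalar2 (c i) * (\<Prod>j\<in>{1..n} - {i}. l j)"
    unfolding eq by (intro dvd_diff dvd_sum dvd_mult) auto
  moreover have prime: "prime_elem (l i)"
    using irreducible_line[OF i] by (simp add: ufd_class.prime_elem_iff_irreducible)
  moreover have "\<not> l i dvd scalar2 (c i)"
    by (rule prime_elem_not_dvd_scalar2[OF prime \<open>c i \<noteq> 0\<close>])
  ultimately have "l i dvd (\<Prod>j\<in>{1..n} - {i}. l j)"
    by (simp add: prime_elem_dvd_mult_iff)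
  then obtain j where "j \<in> {1..n} - {i}" and dvd: "l i dvd l j"
    using prime by (elim prime_elem_dvd_prodE[rotated 2]) simp_all
  then have j: "j \<in> {1..n}" "j \<noteq> i"
    by auto
  from dvd obtain r where r: "l j = l i * r"
    by (elim dvdE)
  then have "l i dvd 1 \<or> r dvd 1"
    by (rule irreducibleD[OF irreducible_line[OF j(1)]])
  then have "r dvd 1"
    using prime by (simp add: prime_elem_def)
  then obtain u where "u \<noteq> 0" "r = scalar2 u"
    unfolding is_unit_iff_scalar2 by blast
  then show False
    using not_associated[OF j(1) i j(2)] r by (metis mult.commute)
qed

text \<open>The scaling multiplies \<open>f\<close> by \<open>u ^ n\<close> and Jacobians by
  \<open>u ^ 2\<close>. It respects the bracket because these factors agree when
  \<open>u ^ (n - 2) = 1\<close>.\<close>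

lemma homogeneous_imp_homothety:
  assumes "homogeneous2 f" and u: "u \<noteq> 0" "u ^ (n - 2) = 1"
  shows "\<exists>\<phi>. poisson_automorphism (to_fract f) \<phi> \<and> homothety \<phi> u"
proof -
  define \<phi> where "\<phi> = fract_map (scale2 u)"
  note simps = fract_scale2_simps[OF u(1), folded \<phi>_def]
  have line: "scale2 u (l i) = scalar2 u * l i" if "i \<in> {1..n}" for i
    using homogeneous_imp_through_origin[OF assms(1) that] l_linform[OF that]
    by (simp add: scale2_linform)
  have hom: "homothety \<phi> u"
    unfolding homothety_def using line by (simp add: simps(2))
  have "scale2 u f = (\<Prod>i\<in>{1..n}. scalar2 u * l i)"
    unfolding f_def scale2_prod by (rule prod.cong[OF refl]) (rule line)
  also have "\<dots> = scalar2 u ^ n * f"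
    by (simp add: prod.distrib f_def)
  finally have f: "scale2 u f = scalar2 u ^ n * f" .
  have pow: "scalar2 u ^ k = scalar2 (u ^ k)" for k
    by (induction k) (simp_all add: scalar2_simps)
  have "n = 2 + (n - 2)"
    using n_ge_4 by simp
  then have "u ^ n = u ^ 2 * u ^ (n - 2)"
    by (metis power_add)
  then have \<phi>_f: "\<phi> (to_fract f) = const (u\<^sup>2) * to_fract f"
    by (simp add: simps(2) f pow u(2))
  have bij: "bij \<phi>"
  proof (rule o_bij)
    show "fract_map (scale2 (1 / u)) \<circ> \<phi> = id"
      using fract_scale2_inverse[OF u(1)] by (auto simp: \<phi>_def)
    show "\<phi> \<circ> fract_map (scale2 (1 / u)) = id"
      using fract_scale2_inverse[of "1 / u"] u(1) by (auto simp: \<phi>_def)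
  qed
  have "\<phi> (poisson_bracket (to_fract f) g h) = poisson_bracket (to_fract f) (\<phi> g) (\<phi> h)" for g h
    using jacobian_fract_scale2[OF u(1), of g h]
    by (simp add: poisson_bracket_jacobian \<phi>_def[symmetric] simps(4) \<phi>_f mult_ac)
  moreover have "\<phi> 1 = 1" "\<phi> (const v) = const v" for v
    using simps(2)[of 1] by (simp_all add: scale2_1 simps(2) scale2_scalar2)
  ultimately have "poisson_automorphism (to_fract f) \<phi>"
    unfolding poisson_automorphism_def using bij by (simp add: simps(3,4))
  then show ?thesis
    using hom by blast
qed

end

section \<open>The exact sequence\<close>

lemma group_Aut_Poi: "group (Aut_Poi (to_fract f))"
proof (rule groupI)
  fix \<phi> \<psi> assume "\<phi> \<in> carrier (Aut_Poi (to_fract f))" "\<psi> \<in> carrier (Aut_Poi (to_fract f))"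
  then show "\<phi> \<otimes>\<^bsub>Aut_Poi (to_fract f)\<^esub> \<psi> \<in> carrier (Aut_Poi (to_fract f))"
    by (auto simp: Aut_Poi_def poisson_automorphism_def intro: bij_comp)
next
  show "\<one>\<^bsub>Aut_Poi (to_fract f)\<^esub> \<in> carrier (Aut_Poi (to_fract f))"
    by (auto simp: Aut_Poi_def poisson_automorphism_def)
next
  fix \<phi> assume "\<phi> \<in> carrier (Aut_Poi (to_fract f))"
  then have \<phi>: "poisson_automorphism (to_fract f) \<phi>"
    by (simp add: Aut_Poi_def)
  then interpret poisson_aut f \<phi>
    by (rule poisson_aut.intro)
  have "inv_into UNIV \<phi> \<circ> \<phi> = id"
    using aut_bij by (simp add: bij_is_inj)
  then show "\<exists>\<psi>\<in>carrier (Aut_Poi (to_fract f)). \<psi> \<otimes>\<^bsub>Aut_Poi (to_fract f)\<^esub> \<phi> = \<one>\<^bsub>Aut_Poi (to_fract f)\<^esub>"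
    using inverse_automorphism by (auto simp: Aut_Poi_def)
qed (simp_all add: Aut_Poi_def comp_assoc)

text \<open>
  Each fibre of \<open>h\<close> is injected into the kernel by composing with the inverse of one of its
  elements.
\<close>

lemma (in group_hom) card_le_kernel_times_codomain:
  assumes "finite (kernel G H h)" "finite (carrier H)"
  shows "finite (carrier G)" "card (carrier G) \<le> card (kernel G H h) * card (carrier H)"
proof -
  define fibre where "fibre y = {x \<in> carrier G. h x = y}" for y
  have fibre: "finite (fibre y) \<and> card (fibre y) \<le> card (kernel G H h)" for y
  proof (cases "fibre y = {}")
    case False
    then obtain z where z: "z \<in> carrier G" "h z = y"
      by (auto simp: fibre_def)
    define g where "g x = inv\<^bsub>G\<^esub> z \<otimes>\<^bsub>G\<^esub> x" for x
    have inj: "inj_on g (fibre y)"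
      using z by (auto simp: inj_on_def g_def fibre_def)
    have sub: "g ` fibre y \<subseteq> kernel G H h"
      using z by (auto simp: g_def fibre_def kernel_def)
    show ?thesis
      using inj_on_finite[OF inj sub assms(1)] card_inj_on_le[OF inj sub assms(1)] by blast
  qed simp
  have union: "carrier G = (\<Union>y\<in>carrier H. fibre y)"
    by (auto simp: fibre_def)
  show "finite (carrier G)"
    unfolding union using fibre assms(2) by blast
  have "card (carrier G) \<le> (\<Sum>y\<in>carrier H. card (fibre y))"
    unfolding union by (rule card_UN_le[OF assms(2)])
  also have "\<dots> \<le> (\<Sum>y\<in>carrier H. card (kernel G H h))"
    using fibre by (intro sum_mono) blast
  finally show "card (carrier G) \<le> card (kernel G H h) * card (carrier H)"
    by (simp add: mult.commute)
qed

section \<open>The kernel and its scaling factors\<close>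

context line_arrangement
begin

abbreviation "G \<equiv> Aut_Poi (to_fract f)"

lemma line_perm_group_hom: "group_hom G (sym_group n) line_perm"
proof -
  have "line_perm \<phi> permutes {1..n}" if "poisson_automorphism (to_fract f) \<phi>" for \<phi>
    using that line_arrangement_automorphism.line_perm_permutes line_arrangement_automorphism_iff
    by blast
  then have "line_perm \<in> hom G (sym_group n)"
    by (auto simp: hom_def Aut_Poi_def sym_group_carrier sym_group_mult line_perm_comp)
  then show ?thesis
    unfolding group_hom_def group_hom_axioms_def using group_Aut_Poi sym_group_is_group by blast
qed

text \<open>One inclusion is \<open>line_perm_id_imp_homothety\<close>. For the other, the equation
  for \<open>u\<close> with n - 2 > 0 excludes \<open>u = 0\<close>, so a scaled line is associated
  to itself only.\<close>

lemma kernel_line_perm: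
  "kernel G (sym_group n) line_perm
    = {\<phi>. poisson_automorphism (to_fract f) \<phi> \<and> (\<exists>u. u ^ (n - 2) = 1 \<and> homothety \<phi> u)}"
proof (intro equalityI subsetI)
  fix \<phi> assume "\<phi> \<in> kernel G (sym_group n) line_perm"
  then have \<phi>: "poisson_automorphism (to_fract f) \<phi>" "line_perm \<phi> = id"
    by (auto simp: kernel_def Aut_Poi_def sym_group_one)
  interpret line_arrangement_automorphism l n a b c f \<phi>
    using \<phi>(1) line_arrangement_automorphism_iff by blast
  show "\<phi> \<in> {\<phi>. poisson_automorphism (to_fract f) \<phi> \<and> (\<exists>u. u ^ (n - 2) = 1 \<and> homothety \<phi> u)}"
    using line_perm_id_imp_homothety[OF \<phi>(2)] \<phi>(1) by blast
next
  fix \<phi> assume "\<phi> \<in> {\<phi>. poisson_automorphism (to_fract f) \<phi> \<and> (\<exists>u. u ^ (n - 2) = 1 \<and> homothety \<phi> u)}"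
  then obtain u where u: "poisson_automorphism (to_fract f) \<phi>" "u ^ (n - 2) = 1" "homothety \<phi> u"
    by blast
  have "u \<noteq> 0"
    using u(2) n_ge_4 by (auto simp: power_0_left)
  then show "\<phi> \<in> kernel G (sym_group n) line_perm"
    using homothety_line_perm[OF u(3)] u(1) by (simp add: kernel_def Aut_Poi_def sym_group_one)
qed

lemma homothety_comp:
  assumes "poisson_automorphism (to_fract f) \<phi>" "homothety \<phi> u" "homothety \<psi> v"
  shows "homothety (\<phi> \<circ> \<psi>) (u * v)"
proof -
  interpret poisson_aut f \<phi>
    by (rule poisson_aut.intro[OF assms(1)])
  show ?thesis
    using homothetyD[OF assms(2)] homothetyD[OF assms(3)]
    by (simp add: homothety_def scalar2_simps mult_ac)
qed

lemma homothety_id: "homothety id 1"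
  by (simp add: homothety_def scalar2_simps)

lemma homothety_inverse:
  assumes "poisson_automorphism (to_fract f) \<phi>" "homothety \<phi> u" "u \<noteq> 0"
  shows "homothety (inv_into UNIV \<phi>) (inverse u)"
  unfolding homothety_def
proof
  interpret poisson_aut f \<phi>
    by (rule poisson_aut.intro[OF assms(1)])
  fix i assume "i \<in> {1..n}"
  then have "\<phi> (const (inverse u) * to_fract (l i)) = const (inverse u) * (const u * to_fract (l i))"
    by (simp only: aut_mult aut_const homothetyD[OF assms(2)])
  also have "\<dots> = const (inverse u * u) * to_fract (l i)"
    by (simp only: scalar2_simps to_fract_mult mult.assoc)
  also have "\<dots> = to_fract (l i)"
    using assms(3) by (simp add: scalar2_simps del: to_fract_mult to_fract_hom.hom_mult)
  finally show "inv_into UNIV \<phi> (to_fract (l i)) = const (inverse u) * to_fract (l i)"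
    using bij_is_inj[OF aut_bij] by (metis inv_f_f)
qed

end

text \<open>The kernel is multiplicative, given by roots of unity, while
  \<open>integer_mod_group\<close> is additive on integers below \<open>m\<close>; a fixed primitive
  root translates between them.\<close>

locale line_arrangement_root_of_unity = line_arrangement l n a b c f
  for l :: "nat \<Rightarrow> 'k::field poly poly" and n a b c f +
  fixes \<zeta> :: 'k and m :: nat
  defines "m \<equiv> n - 2"
  assumes primitive: "\<zeta> ^ k = 1 \<longleftrightarrow> m dvd k"
begin

lemma m_pos: "m > 0"
  using n_ge_4 by (simp add: m_def)

lemma \<zeta>_nonzero: "\<zeta> \<noteq> 0"
  using primitive[of m] m_pos by (auto simp: power_0_left)

lemma powi_mod: "\<zeta> powi (k mod int m) = \<zeta> powi k"
proof -
  have "\<zeta> powi (int m * (k div int m)) = 1"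
    using primitive[of m] by (simp add: power_int_mult)
  moreover have "\<zeta> powi k = \<zeta> powi (int m * (k div int m)) * \<zeta> powi (k mod int m)"
    using \<zeta>_nonzero by (simp add: power_int_add[symmetric])
  ultimately show ?thesis
    by simp
qed

lemma powi_power_m: "(\<zeta> powi k) ^ m = 1"
proof -
  have "(\<zeta> powi k) ^ m = \<zeta> powi (k * int m)"
    by (simp add: power_int_mult)
  also have "\<dots> = (\<zeta> powi int m) powi k"
    by (simp only: mult.commute[of k] power_int_mult)
  finally show ?thesis
    using primitive[of m] by simp
qed

text \<open>The discrete logarithms of the scaling factors that occur: this is the group C.\<close>

definition exponents :: "int set" where
  "exponents = {k \<in> {0..<int m}. \<exists>\<phi>. poisson_automorphism (to_fract f) \<phi> \<and> homothety \<phi> (\<zeta> powi k)}"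

text \<open>The embedding of C. By \<open>homothety_eqI\<close> there is at most one such
  automorphism; the value is unspecified if there is none.\<close>

definition homothety_of :: "int \<Rightarrow> 'k poly poly fract \<Rightarrow> 'k poly poly fract" where
  "homothety_of k = (THE \<phi>. poisson_automorphism (to_fract f) \<phi> \<and> homothety \<phi> (\<zeta> powi k))"

lemma carrier_m: "carrier (integer_mod_group m) = {0..<int m}"
  using m_pos by (simp add: carrier_integer_mod_group)

lemma homothety_of_eqI:
  assumes "poisson_automorphism (to_fract f) \<phi>" "homothety \<phi> (\<zeta> powi k)"
  shows "homothety_of k = \<phi>"
  unfolding homothety_of_def using assms homothety_eqI by (intro the_equality) blast+

lemma homothety_of:
  assumes "k \<in> exponents"
  shows "poisson_automorphism (to_fract f) (homothety_of k)" "homothety (homothety_of k) (\<zeta> powi k)"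
proof -
  obtain \<phi> where "poisson_automorphism (to_fract f) \<phi>" "homothety \<phi> (\<zeta> powi k)"
    using assms by (auto simp: exponents_def)
  then show "poisson_automorphism (to_fract f) (homothety_of k)" "homothety (homothety_of k) (\<zeta> powi k)"
    using homothety_of_eqI by simp_all
qed

lemma comp_closed:
  assumes "poisson_automorphism (to_fract f) \<phi>" "poisson_automorphism (to_fract f) \<psi>"
  shows "poisson_automorphism (to_fract f) (\<phi> \<circ> \<psi>)"
  using monoid.m_closed[OF group.is_monoid[OF group_Aut_Poi], of \<phi> f \<psi>] assms
  by (simp add: Aut_Poi_def)

lemma homothety_of_add:
  assumes "k \<in> exponents" "j \<in> exponents"
  shows "(k + j) mod int m \<in> exponents"
    "homothety_of ((k + j) mod int m) = homothety_of k \<circ> homothety_of j"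
proof -
  have "homothety (homothety_of k \<circ> homothety_of j) (\<zeta> powi ((k + j) mod int m))"
    using homothety_comp[OF homothety_of(1,2)[OF assms(1)] homothety_of(2)[OF assms(2)]] \<zeta>_nonzero
    by (simp add: powi_mod power_int_add)
  moreover have aut: "poisson_automorphism (to_fract f) (homothety_of k \<circ> homothety_of j)"
    using comp_closed homothety_of(1) assms by blast
  moreover have "(k + j) mod int m \<in> {0..<int m}"
    using m_pos by simp
  ultimately show "(k + j) mod int m \<in> exponents"
    "homothety_of ((k + j) mod int m) = homothety_of k \<circ> homothety_of j"
    unfolding exponents_def by (blast intro: homothety_of_eqI)+
qed

lemma subgroup_exponents: "subgroup exponents (integer_mod_group m)"
proof (rule group.subgroupI[OF group_integer_mod_group])
  show "exponents \<subseteq> carrier (integer_mod_group m)"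
    by (auto simp: exponents_def carrier_m)
  have "poisson_automorphism (to_fract f) id"
    by (auto simp: poisson_automorphism_def)
  then have "0 \<in> exponents"
    using homothety_id m_pos by (auto simp: exponents_def)
  then show "exponents \<noteq> {}"
    by blast
next
  fix k assume k: "k \<in> exponents"
  interpret poisson_aut f "homothety_of k"
    by (rule poisson_aut.intro[OF homothety_of(1)[OF k]])
  have "homothety (inv_into UNIV (homothety_of k)) (\<zeta> powi (- k mod int m))"
    using homothety_inverse[OF homothety_of[OF k]] \<zeta>_nonzero by (simp add: powi_mod power_int_minus)
  then have "- k mod int m \<in> exponents"
    using inverse_automorphism m_pos by (auto simp: exponents_def)
  moreover have "k \<in> carrier (integer_mod_group m)"
    using k by (auto simp: exponents_def carrier_m)
  ultimately show "inv\<^bsub>integer_mod_group m\<^esub> k \<in> exponents"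
    by simp
next
  fix k j assume "k \<in> exponents" "j \<in> exponents"
  then show "k \<otimes>\<^bsub>integer_mod_group m\<^esub> j \<in> exponents"
    by (simp add: homothety_of_add(1))
qed

lemma homothety_of_image: "homothety_of ` exponents = kernel G (sym_group n) line_perm"
  unfolding kernel_line_perm
proof (intro equalityI subsetI)
  fix \<phi> assume "\<phi> \<in> homothety_of ` exponents"
  then obtain k where k: "k \<in> exponents" "\<phi> = homothety_of k"
    by blast
  have "(\<zeta> powi k) ^ m = 1"
    by (rule powi_power_m)
  then show "\<phi> \<in> {\<phi>. poisson_automorphism (to_fract f) \<phi> \<and> (\<exists>u. u ^ (n - 2) = 1 \<and> homothety \<phi> u)}"
    using homothety_of[OF k(1)] k(2) by (auto simp: m_def)
next
  fix \<phi> assume "\<phi> \<in> {\<phi>. poisson_automorphism (to_fract f) \<phi> \<and> (\<exists>u. u ^ (n - 2) = 1 \<and> homothety \<phi> u)}"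
  then obtain u where u: "poisson_automorphism (to_fract f) \<phi>" "u ^ m = 1" "homothety \<phi> u"
    by (auto simp: m_def)
  obtain k where k: "k < m" "u = \<zeta> ^ k"
    using root_of_unity_conv_primitive[OF primitive m_pos u(2)] .
  then have "homothety \<phi> (\<zeta> powi int k)"
    using u(3) by simp
  then have "int k \<in> exponents" "homothety_of (int k) = \<phi>"
    using u(1) k(1) homothety_of_eqI by (auto simp: exponents_def)
  then show "\<phi> \<in> homothety_of ` exponents"
    by blast
qed

lemma left_exact_homothety_of:
  "left_exact ((integer_mod_group m)\<lparr>carrier := exponents\<rparr>) homothety_of G line_perm (sym_group n)"
proof -
  let ?C = "(integer_mod_group m)\<lparr>carrier := exponents\<rparr>"
  have "homothety_of \<in> hom ?C G"
    using homothety_of(1) homothety_of_add(2) by (auto simp: hom_def Aut_Poi_def)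
  then have hom: "group_hom ?C G homothety_of"
    unfolding group_hom_def group_hom_axioms_def
    using group_Aut_Poi subgroup.subgroup_is_group[OF subgroup_exponents group_integer_mod_group]
    by blast
  \<comment> \<open>The identity has the unique factor 1, and below \<open>m\<close> the only
    exponent of a primitive root giving 1 is 0.\<close>
  have "k = 0" if k: "k \<in> exponents" "homothety_of k = id" for k
  proof -
    have "\<zeta> powi k = 1"
      using homothety_unique[OF homothety_of(2)[OF k(1)]] homothety_id k(2) by simp
    then have "\<zeta> ^ nat k = 1"
      using k(1) by (simp add: exponents_def power_int_def)
    then have "m dvd nat k"
      by (simp only: primitive)
    then show ?thesis
      using k(1) by (auto simp: exponents_def dest: dvd_imp_le)
  qed
  moreover have "0 \<in> exponents" "homothety_of 0 = id"
  proof -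
    have "poisson_automorphism (to_fract f) id"
      by (auto simp: poisson_automorphism_def)
    then show "0 \<in> exponents" "homothety_of 0 = id"
      using homothety_id m_pos homothety_of_eqI[of id 0] by (auto simp: exponents_def)
  qed
  ultimately have "kernel ?C G homothety_of = {\<one>\<^bsub>?C\<^esub>}"
    by (auto simp: kernel_def Aut_Poi_def)
  then show ?thesis
    unfolding left_exact_def using hom line_perm_group_hom homothety_of_image by simp
qed

lemma homogeneous_imp_exponents:
  assumes "homogeneous2 f"
  shows "exponents = carrier (integer_mod_group m)"
proof -
  have "k \<in> exponents" if k: "k \<in> {0..<int m}" for k
  proof -
    have "(\<zeta> powi k) ^ m = 1"
      by (rule powi_power_m)
    moreover have "\<zeta> powi k \<noteq> 0"
      using \<zeta>_nonzero by simp
    ultimately show ?thesis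
      using homogeneous_imp_homothety[OF assms, of "\<zeta> powi k"] k by (auto simp: exponents_def m_def)
  qed
  then show ?thesis
    unfolding carrier_m by (auto simp: exponents_def)
qed

section \<open>Bounds on the order of the automorphism group\<close>

lemma card_exponents: "finite exponents" "card exponents \<le> m"
proof -
  have "exponents \<subseteq> {0..<int m}"
    by (auto simp: exponents_def)
  then show "finite exponents" "card exponents \<le> m"
    using finite_subset[of exponents "{0..<int m}"] card_mono[of "{0..<int m}" exponents]
    by simp_all
qed

lemma finite_Aut_Poi: "finite (carrier G)"
  and card_Aut_Poi_le: "card (carrier G) \<le> m * fact n"
proof -
  interpret group_hom G "sym_group n" line_perm
    by (rule line_perm_group_hom)
  have "finite (kernel G (sym_group n) line_perm)"
    unfolding homothety_of_image[symmetric] using card_exponents by blast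
  moreover have "finite (carrier (sym_group n))"
    by (rule card_ge_0_finite) (simp add: sym_group_card_carrier)
  moreover have "card (kernel G (sym_group n) line_perm) \<le> m"
    unfolding homothety_of_image[symmetric] using card_exponents card_image_le le_trans by blast
  ultimately show "finite (carrier G)" "card (carrier G) \<le> m * fact n"
    using card_le_kernel_times_codomain
      mult_le_mono1[of "card (kernel G (sym_group n) line_perm)" m "fact n"]
    by (auto simp: sym_group_card_carrier intro: le_trans)
qed

lemma homogeneous_imp_card_Aut_Poi_ge:
  assumes "homogeneous2 f"
  shows "m \<le> card (carrier G)"
proof -
  have "inj_on homothety_of (carrier ((integer_mod_group m)\<lparr>carrier := exponents\<rparr>))"
    using left_exact_homothety_of unfolding left_exact_def
    by (elim conjE) (rule group_hom.trivial_ker_imp_inj)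
  then have inj: "inj_on homothety_of exponents"
    by simp
  have "m = card exponents"
    using homogeneous_imp_exponents[OF assms] by (simp add: carrier_m)
  also have "\<dots> = card (homothety_of ` exponents)"
    using inj by (simp add: card_image)
  \<comment> \<open>Finiteness of the carrier is essential here: an infinite set would have
    \<open>card\<close> 0.\<close>
  also have "\<dots> \<le> card (carrier G)"
    using finite_Aut_Poi homothety_of(1) by (intro card_mono) (auto simp: Aut_Poi_def)
  finally show ?thesis .
qed

end

theorem theorem6p6:
  fixes f :: "'k::{alg_closed_field, field_char_0} poly poly"
    and l :: "nat \<Rightarrow> 'k poly poly"
    and n :: nat
  assumes "n \<ge> 4"
    and "total_degree2 f = n"
    and "f = (\<Prod>i\<in>{1..n}. l i)"
    and "\<And>i. i \<in> {1..n} \<Longrightarrow> linear_form2 (l i)"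
    and "\<And>i j u. i \<in> {1..n} \<Longrightarrow> j \<in> {1..n} \<Longrightarrow> i \<noteq> j \<Longrightarrow> u \<noteq> 0 \<Longrightarrow> l i \<noteq> scalar2 u * l j"
    and "\<And>i. i \<in> {1..n} \<Longrightarrow> card {j \<in> {1..n}. generates2 {l i, l j}} \<ge> 3"
  shows "(\<exists>C \<iota> \<pi>.
            subgroup C (integer_mod_group (n - 2)) \<and>
            left_exact ((integer_mod_group (n - 2))\<lparr>carrier := C\<rparr>) \<iota>
              (Aut_Poi (to_fract f)) \<pi> (sym_group n) \<and>
            (homogeneous2 f \<longrightarrow> C = carrier (integer_mod_group (n - 2))))
         \<and> finite (carrier (Aut_Poi (to_fract f)))
         \<and> card (carrier (Aut_Poi (to_fract f))) \<le> (n - 2) * fact n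
         \<and> (homogeneous2 f \<longrightarrow> n - 2 \<le> card (carrier (Aut_Poi (to_fract f))))"
proof -
  have "\<forall>i. \<exists>a b c. i \<in> {1..n} \<longrightarrow> l i = linform a b c \<and> (a \<noteq> 0 \<or> b \<noteq> 0)"
    using assms(4) unfolding linear_form2_iff by blast
  then obtain a b c where lines:
      "\<And>i. i \<in> {1..n} \<Longrightarrow> l i = linform (a i) (b i) (c i) \<and> (a i \<noteq> 0 \<or> b i \<noteq> 0)"
    by metis
  \<comment> \<open>Algebraic closedness and characteristic zero enter here.\<close>
  obtain \<zeta> :: 'k where \<zeta>: "\<And>k. \<zeta> ^ k = 1 \<longleftrightarrow> n - 2 dvd k"
    using exists_primitive_root_of_unity[of "n - 2"] assms(1) by auto
  interpret line_arrangement_root_of_unity l n a b c f \<zeta> "n - 2"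
  proof unfold_locales
    fix i assume i: "i \<in> {1..n}"
    \<comment> \<open>Generating pairs are transversal, so the count of three carries over to
      determinants.\<close>
    have "{j \<in> {1..n}. generates2 {l i, l j}} \<subseteq> {j \<in> {1..n}. a i * b j - a j * b i \<noteq> 0}"
    proof
      fix j assume "j \<in> {j \<in> {1..n}. generates2 {l i, l j}}"
      then have j: "j \<in> {1..n}" "generates2 {l i, l j}"
        by blast+
      have "a i * b j - a j * b i \<noteq> 0"
        using generates2_linforms_imp_det[of "a i" "b i" "c i" "a j" "b j" "c j"] j
          lines[OF i] lines[OF j(1)] by simp
      then show "j \<in> {j \<in> {1..n}. a i * b j - a j * b i \<noteq> 0}"
        using j(1) by blast
    qed
    then have "card {j \<in> {1..n}. generates2 {l i, l j}} \<le> card {j \<in> {1..n}. a i * b j - a j * b i \<noteq> 0}"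
      by (intro card_mono) simp_all
    then show "3 \<le> card {j \<in> {1..n}. a i * b j - a j * b i \<noteq> 0}"
      using assms(6)[OF i] by linarith
  qed (use assms lines \<zeta> in auto)
  show ?thesis
    using subgroup_exponents left_exact_homothety_of homogeneous_imp_exponents
      finite_Aut_Poi card_Aut_Poi_le homogeneous_imp_card_Aut_Poi_ge by blast
qed

end
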